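(* $\mathbb{C}(\mathcal{Y}_1)=\mathbb{C}(T)$, where $T=\left(\dfrac{a-2}{5(a+2)}\right)^2$.
   Context: $\mathcal{M}_2$ is the moduli space of genus 2 curves over $\mathbb{C}$. A degree 5 cover $\psi:C\to E$ from a genus 2 curve to a genus 1 curve induces a degree 5 cover $\phi:\mathbb{P}^1\to\mathbb{P}^1$ with $\phi\circ\pi_C=\pi_E\circ\psi$, where $\pi_C:C\to\mathbb{P}^1$, $\pi_E:E\to\mathbb{P}^1$ are the natural degree 2 covers. $\mathcal{Y}_1\subset\mathcal{M}_2$ is the locus of genus 2 curves $C$ admitting a degree 5 cover $\psi:C\to E$ to a genus 1 curve such that $\phi$ is of degenerate type I, i.e. has exactly four branch points, with ramification indices $>1$ over them given by $((2)^2,(2)^2,(4),(2))$. Normal form: with a parameter $a$, put $b=a^2/4$, $z=\frac{a(a+8)}{4(2a+1)}$, $\varphi(X)=X\,F_1(X)^2/F_2(X)^2$, $F_1(X)=X^2+(2a+2b+a^2)X+2ab+b^2$, $F_2(X)=(2a+1)X^2+(a^2+2ab+2b)X+b^2$. The numerator of $\varphi(X)-\varphi(z)$ is a nonzero constant times $(X-z)^2g_3(X)$ with $g_3$ a cubic, and the curves in $\mathcal{Y}_1$ are those of the form $C_a:\ y^2=x(x-1)g_3(x)$. The absolute invariants of a genus 2 curve are $i_1=144J_4/J_2^2$, $i_2=-1728(J_2J_4-3J_6)/J_2^3$, $i_3=486J_{10}/J_2^5$, where $J_2,J_4,J_6,J_{10}$ are the classical (Igusa) invariants of binary sextics. With $a$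 transcendental over $\mathbb{C}$, the function field $\mathbb{C}(\mathcal{Y}_1)$ is regarded as the subfield of $\mathbb{C}(a)$ generated by the absolute invariants $i_1,i_2,i_3$ of $C_a$. *)

theory Defs
  imports
    "HOL-Algebra.Algebraic_Closure_Type"
    "HOL-Algebra.Generated_Fields"
    "Subresultants.Resultant_Prelim"
begin

section \<open>Igusa invariants of binary sextics\<close>

text \<open>
  A polynomial \<open>f\<close> of degree at most 6 stands for the binary sextic
  \<open>F(X,Z) = a\<^sub>0 Z\<^sup>6 + a\<^sub>1 X Z\<^sup>5 + \<dots> + a\<^sub>6 X\<^sup>6\<close>, \<open>a\<^sub>i = coeff f i\<close>. In particular a quintic
  is a sextic with a root at infinity. The normalization is Igusa's (his \<open>A\<close>, \<open>B\<close>, \<open>C\<close>, \<open>D\<close>): for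
  \<open>F = (y\<^sub>1 X - x\<^sub>1 Z) \<dots> (y\<^sub>6 X - x\<^sub>6 Z)\<close> and \<open>(ij) = x\<^sub>i y\<^sub>j - x\<^sub>j y\<^sub>i\<close>,
    \<^item> \<open>J\<^sub>2\<close> is the sum of the 15 terms of type \<open>(12)\<^sup>2(34)\<^sup>2(56)\<^sup>2\<close>,
    \<^item> \<open>J\<^sub>4\<close> is the sum of the 10 terms of type \<open>(12)\<^sup>2(23)\<^sup>2(31)\<^sup>2(45)\<^sup>2(56)\<^sup>2(64)\<^sup>2\<close>,
    \<^item> \<open>J\<^sub>6\<close> is the sum of the 60 terms of type
      \<open>(12)\<^sup>2(23)\<^sup>2(31)\<^sup>2(45)\<^sup>2(56)\<^sup>2(64)\<^sup>2(14)\<^sup>2(25)\<^sup>2(36)\<^sup>2\<close>,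
    \<^item> \<open>J\<^sub>1\<^sub>0\<close> is the discriminant, the product of all \<open>(ij)\<^sup>2\<close> with \<open>i < j\<close>.
  The definitions below are these invariants written in the coefficients.
\<close>

definition J2 :: "'a::field poly \<Rightarrow> 'a" where
  "J2 f = (let a = coeff f in
    40 * a 1 * a 5 + 6 * a 3 ^ 2 - 240 * a 0 * a 6 - 16 * a 2 * a 4)"

definition J4 :: "'a::field poly \<Rightarrow> 'a" where
  "J4 f = (let a = coeff f in
    1620 * a 0 ^ 2 * a 6 ^ 2 - 540 * a 0 * a 1 * a 5 * a 6 - 504 * a 0 * a 2 * a 4 * a 6
     + 300 * a 0 * a 2 * a 5 ^ 2 + 324 * a 0 * a 3 ^ 2 * a 6 - 180 * a 0 * a 3 * a 4 * a 5
     + 48 * a 0 * a 4 ^ 3 + 300 * a 1 ^ 2 * a 4 * a 6 - 80 * a 1 ^ 2 * a 5 ^ 2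
     - 180 * a 1 * a 2 * a 3 * a 6 + 4 * a 1 * a 2 * a 4 * a 5 + 36 * a 1 * a 3 ^ 2 * a 5
     - 12 * a 1 * a 3 * a 4 ^ 2 + 48 * a 2 ^ 3 * a 6 - 12 * a 2 ^ 2 * a 3 * a 5
     + 4 * a 2 ^ 2 * a 4 ^ 2)"

definition J6 :: "'a::field poly \<Rightarrow> 'a" where
  "J6 f = (let a = coeff f in
    59940 * a 0 ^ 2 * a 1 * a 5 * a 6 ^ 2 - 119880 * a 0 ^ 3 * a 6 ^ 3
     + 20664 * a 0 ^ 2 * a 2 * a 4 * a 6 ^ 2 - 18600 * a 0 ^ 2 * a 2 * a 5 ^ 2 * a 6
     - 10044 * a 0 ^ 2 * a 3 ^ 2 * a 6 ^ 2 + 3060 * a 0 ^ 2 * a 3 * a 4 * a 5 * a 6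
     + 2250 * a 0 ^ 2 * a 3 * a 5 ^ 3 - 96 * a 0 ^ 2 * a 4 ^ 3 * a 6
     - 900 * a 0 ^ 2 * a 4 ^ 2 * a 5 ^ 2 - 18600 * a 0 * a 1 ^ 2 * a 4 * a 6 ^ 2
     - 2240 * a 0 * a 1 ^ 2 * a 5 ^ 2 * a 6 + 3060 * a 0 * a 1 * a 2 * a 3 * a 6 ^ 2
     + 3472 * a 0 * a 1 * a 2 * a 4 * a 5 * a 6 + 1600 * a 0 * a 1 * a 2 * a 5 ^ 3
     + 1818 * a 0 * a 1 * a 3 ^ 2 * a 5 * a 6 - 876 * a 0 * a 1 * a 3 * a 4 ^ 2 * a 6
     - 1860 * a 0 * a 1 * a 3 * a 4 * a 5 ^ 2 + 616 * a 0 * a 1 * a 4 ^ 3 * a 5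
     - 96 * a 0 * a 2 ^ 3 * a 6 ^ 2 - 876 * a 0 * a 2 ^ 2 * a 3 * a 5 * a 6
     + 424 * a 0 * a 2 ^ 2 * a 4 ^ 2 * a 6 - 640 * a 0 * a 2 ^ 2 * a 4 * a 5 ^ 2
     - 468 * a 0 * a 2 * a 3 ^ 2 * a 4 * a 6 + 330 * a 0 * a 2 * a 3 ^ 2 * a 5 ^ 2
     + 492 * a 0 * a 2 * a 3 * a 4 ^ 2 * a 5 - 160 * a 0 * a 2 * a 4 ^ 4
     + 162 * a 0 * a 3 ^ 4 * a 6 - 198 * a 0 * a 3 ^ 3 * a 4 * a 5
     + 60 * a 0 * a 3 ^ 2 * a 4 ^ 3 + 2250 * a 1 ^ 3 * a 3 * a 6 ^ 2
     + 1600 * a 1 ^ 3 * a 4 * a 5 * a 6 - 320 * a 1 ^ 3 * a 5 ^ 3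
     - 900 * a 1 ^ 2 * a 2 ^ 2 * a 6 ^ 2 - 1860 * a 1 ^ 2 * a 2 * a 3 * a 5 * a 6
     - 640 * a 1 ^ 2 * a 2 * a 4 ^ 2 * a 6 + 64 * a 1 ^ 2 * a 2 * a 4 * a 5 ^ 2
     + 330 * a 1 ^ 2 * a 3 ^ 2 * a 4 * a 6 + 176 * a 1 ^ 2 * a 3 ^ 2 * a 5 ^ 2
     + 26 * a 1 ^ 2 * a 3 * a 4 ^ 2 * a 5 - 36 * a 1 ^ 2 * a 4 ^ 4
     + 616 * a 1 * a 2 ^ 3 * a 5 * a 6 + 492 * a 1 * a 2 ^ 2 * a 3 * a 4 * a 6
     + 26 * a 1 * a 2 ^ 2 * a 3 * a 5 ^ 2 + 28 * a 1 * a 2 ^ 2 * a 4 ^ 2 * a 5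
     - 198 * a 1 * a 2 * a 3 ^ 3 * a 6 - 238 * a 1 * a 2 * a 3 ^ 2 * a 4 * a 5
     + 76 * a 1 * a 2 * a 3 * a 4 ^ 3 + 72 * a 1 * a 3 ^ 4 * a 5 - 24 * a 1 * a 3 ^ 3 * a 4 ^ 2
     - 160 * a 2 ^ 4 * a 4 * a 6 - 36 * a 2 ^ 4 * a 5 ^ 2 + 60 * a 2 ^ 3 * a 3 ^ 2 * a 6
     + 76 * a 2 ^ 3 * a 3 * a 4 * a 5 - 24 * a 2 ^ 3 * a 4 ^ 3 - 24 * a 2 ^ 2 * a 3 ^ 3 * a 5
     + 8 * a 2 ^ 2 * a 3 ^ 2 * a 4 ^ 2)"

text \<open>
  \<open>disc F = - Res(\<partial>F/\<partial>X, \<partial>F/\<partial>Z) / 6\<^sup>4\<close>, the resultant being that of two binary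
  quintics. Hence the formal degrees 5 even where leading coefficients vanish. After setting
  \<open>Z = 1\<close>, Euler's identity gives \<open>\<partial>F/\<partial>Z = 6 F - X \<partial>F/\<partial>X\<close>.
\<close>

definition J10 :: "'a::field poly \<Rightarrow> 'a" where
  "J10 f = - resultant_sub 5 5 (pderiv f) (Polynomial.smult 6 f - [:0, 1:] * pderiv f) / 6 ^ 4"

definition i1 :: "'a::field poly \<Rightarrow> 'a" where
  "i1 f = 144 * J4 f / J2 f ^ 2"

definition i2 :: "'a::field poly \<Rightarrow> 'a" where
  "i2 f = - 1728 * (J2 f * J4 f - 3 * J6 f) / J2 f ^ 3"

definition i3 :: "'a::field poly \<Rightarrow> 'a" where
  "i3 f = 486 * J10 f / J2 f ^ 5"


section \<open>The family \<open>C\<^sub>a\<close>\<close>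

definition b_of :: "'a::field \<Rightarrow> 'a" where
  "b_of a = a ^ 2 / 4"

definition z_of :: "'a::field \<Rightarrow> 'a" where
  "z_of a = a * (a + 8) / (4 * (2 * a + 1))"

definition F1 :: "'a::field \<Rightarrow> 'a poly" where
  "F1 a = (let b = b_of a in [: 2 * a * b + b ^ 2, 2 * a + 2 * b + a ^ 2, 1 :])"

definition F2 :: "'a::field \<Rightarrow> 'a poly" where
  "F2 a = (let b = b_of a in [: b ^ 2, a ^ 2 + 2 * a * b + 2 * b, 2 * a + 1 :])"

definition phi :: "'a::field \<Rightarrow> 'a \<Rightarrow> 'a" where
  "phi a x = x * poly (F1 a) x ^ 2 / poly (F2 a) x ^ 2"

text \<open>The numerator of \<open>\<phi>(X) - \<phi>(z)\<close> over the denominator \<open>F\<^sub>2(X)\<^sup>2\<close>.\<close>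

definition phi_num :: "'a::field \<Rightarrow> 'a poly" where
  "phi_num a = [:0, 1:] * F1 a ^ 2 - Polynomial.smult (phi a (z_of a)) (F2 a ^ 2)"

text \<open>
  The cubic \<open>g\<^sub>3\<close> is determined up to a nonzero constant factor, which does not affect the
  absolute invariants. The division is exact; see \<open>phi_num_Ca\<close> below.
\<close>

definition g3 :: "'a::field \<Rightarrow> 'a poly" where
  "g3 a = phi_num a div [:- z_of a, 1:] ^ 2"

definition sextic_C :: "'a::field \<Rightarrow> 'a poly" where
  "sextic_C a = [:0, 1:] * [:- 1, 1:] * g3 a"


section \<open>Subfields of \<open>\<complex>(a)\<close>\<close>

type_synonym ratfun = "complex poly fract"

definition const_rf :: "complex \<Rightarrow> ratfun" where
  "const_rf c = Fraction_Field.Fract [:c:] 1"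

definition a_rf :: ratfun where
  "a_rf = Fraction_Field.Fract [:0, 1:] 1"

definition C_adjoin :: "ratfun set \<Rightarrow> ratfun set" where
  "C_adjoin S = generate_field ring_of_type_algebra (range const_rf \<union> S)"

definition function_field_Y1 :: "ratfun set" where
  "function_field_Y1 = C_adjoin {i1 (sextic_C a_rf), i2 (sextic_C a_rf), i3 (sextic_C a_rf)}"


section \<open>Exactness of the division defining \<open>g\<^sub>3\<close>\<close>

lemma phi_num_eq:
  fixes a :: "'a::field"
  assumes nz: "2 \<noteq> (0::'a)" "2 * a + 1 \<noteq> 0" "poly (F2 a) (z_of a) \<noteq> 0"
  shows "phi_num a = [:- z_of a, 1:] ^ 2 * g3 a" and "degree (g3 a) = 3"
proof -
  define z where "z = z_of a"
  define N where "N = phi_num a"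
  define A where "A = poly (F1 a) z"
  define B where "B = poly (F2 a) z"
  define A' where "A' = poly (pderiv (F1 a)) z"
  define B' where "B' = poly (pderiv (F2 a)) z"
  have B: "B \<noteq> 0" using nz by (simp add: B_def z_def)
  have four: "4 \<noteq> (0::'a)"
    using nz(1) by (metis mult_2_right mult_eq_0_iff numeral_Bit0)
  define w where "w = 4 * (2 * a + 1)"
  have w: "w \<noteq> 0" unfolding w_def using nz(2) four by (rule_tac no_zero_divisors)
  have zw: "z * w = a * (a + 8)" using w by (simp add: z_def z_of_def w_def)
  define b where "b = b_of a"
  have b4: "b * 4 = a ^ 2" using four by (simp add: b_def b_of_def)
  have A: "A = z ^ 2 + (2 * a + 2 * b + a ^ 2) * z + 2 * a * b + b ^ 2"
    by (simp add: A_def F1_def Let_def b_def algebra_simps power2_eq_square)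
  have B_eq: "B = (2 * a + 1) * z ^ 2 + (a ^ 2 + 2 * a * b + 2 * b) * z + b ^ 2"
    by (simp add: B_def F2_def Let_def b_def algebra_simps power2_eq_square)
  have A': "A' = 2 * z + (2 * a + 2 * b + a ^ 2)"
    by (simp add: A'_def F1_def Let_def b_def pderiv_pCons algebra_simps)
  have B'_eq: "B' = 2 * (2 * a + 1) * z + (a ^ 2 + 2 * a * b + 2 * b)"
    by (simp add: B'_def F2_def Let_def b_def pderiv_pCons algebra_simps)
  obtain c where c: "a = 2 * c" using nz(1) by (metis nonzero_mult_div_cancel_left times_divide_eq_right)
  have "4 * b = 4 * c ^ 2" using b4 by (simp add: c power2_eq_square algebra_simps)
  then have b: "b = c ^ 2" using four by (metis mult_left_cancel)
  have "4 * (A * B + 2 * z * (A' * B - A * B')) = (z * w - a * (a + 8)) * (z - b) ^ 3"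
    unfolding A B_eq A' B'_eq w_def c b
    by (simp add: algebra_simps power2_eq_square power3_eq_cube)
  then have "A * B + 2 * z * (A' * B - A * B') = 0"
    using four by (simp only: zw) (metis diff_self mult_eq_0_iff mult_zero_left)
  then have key: "A * B + 2 * z * A' * B = 2 * z * A * B'"
    by (simp add: algebra_simps)
  have phi: "phi a z = z * A ^ 2 / B ^ 2"
    by (simp add: phi_def A_def B_def)
  have N0: "poly N z = 0"
    using B by (simp add: N_def phi_num_def flip: z_def) (simp add: phi flip: A_def B_def)
  have "poly (pderiv N) z = A ^ 2 + 2 * z * A * A' - phi a z * (2 * B * B')"
    by (simp add: N_def phi_num_def pderiv_diff pderiv_mult pderiv_smult pderiv_pCons
        power2_eq_square algebra_simps flip: z_def A_def B_def A'_def B'_def)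
  also have "\<dots> = A / B * (A * B + 2 * z * A' * B - 2 * z * A * B')"
    using B by (simp add: phi field_simps power2_eq_square)
  also have "\<dots> = 0"
    using key by simp
  finally have N1: "poly (pderiv N) z = 0" .
  obtain q where q: "N = [:- z, 1:] * q"
    using N0 by (auto simp: poly_eq_0_iff_dvd elim: dvdE)
  have "poly q z = 0"
    using N1 unfolding q pderiv_mult by (simp add: pderiv_pCons)
  then obtain r where r: "q = [:- z, 1:] * r"
    by (auto simp: poly_eq_0_iff_dvd elim: dvdE)
  have N: "N = [:- z, 1:] ^ 2 * r"
    by (simp only: q r power2_eq_square mult.assoc)
  then have g3: "g3 a = r"
    by (simp add: g3_def N_def z_def)
  with N show "phi_num a = [:- z_of a, 1:] ^ 2 * g3 a"
    by (simp add: N_def z_def)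
  have F1: "degree (F1 a) = 2" "F1 a \<noteq> 0" by (simp_all add: F1_def Let_def)
  have F2: "degree (F2 a) = 2" using nz by (simp add: F2_def Let_def)
  have "degree ([:0, 1:] * F1 a ^ 2) = 5"
    using F1 by (subst degree_mult_eq) (auto simp: degree_power_eq)
  moreover have "degree (Polynomial.smult (phi a z) (F2 a ^ 2)) < 5"
    using F2 by (intro le_less_trans[OF degree_smult_le] le_less_trans[OF degree_power_le]) simp
  ultimately have "degree N = 5"
    unfolding N_def phi_num_def z_def diff_conv_add_uminus
    by (subst degree_add_eq_left) (simp_all only: degree_minus)
  moreover from this have "r \<noteq> 0"
    by (auto simp: N)
  then have "degree N = 2 + degree r"
    unfolding N by (subst degree_mult_eq) (auto simp: degree_power_eq)
  ultimately show "degree (g3 a) = 3"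
    by (simp add: g3)
qed

lemma poly_F2_z:
  fixes a :: "'a::field"
  assumes "2 \<noteq> (0::'a)" "2 * a + 1 \<noteq> 0"
  shows "4 * (2 * a + 1) * poly (F2 a) (z_of a) = a ^ 2 * (a + 2) * (a ^ 2 + 4 * a + 8)"
proof -
  have four: "4 \<noteq> (0::'a)"
    using assms(1) by (metis mult_2_right mult_eq_0_iff numeral_Bit0)
  define z where "z = z_of a"
  define b where "b = b_of a"
  have zw: "4 * (2 * a + 1) * z = a * (a + 8)"
    using assms(2) four no_zero_divisors[OF four assms(2)]
    by (simp only: z_def z_of_def nonzero_mult_div_cancel_left times_divide_eq_right not_False_eq_True)
  have b4: "4 * b = a ^ 2" using four by (simp add: b_def b_of_def)
  obtain c where c: "a = 2 * c" using assms(1) by (metis nonzero_mult_div_cancel_left times_divide_eq_right)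
  have "4 * b = 4 * c ^ 2" using b4 by (simp add: c power2_eq_square algebra_simps)
  then have b: "b = c ^ 2" using four by (metis mult_left_cancel)
  have "4 * (4 * (2 * a + 1) * poly (F2 a) z) =
    (4 * (2 * a + 1) * z) ^ 2 + 4 * (a ^ 2 + 2 * a * b + 2 * b) * (4 * (2 * a + 1) * z) + 16 * (2 * a + 1) * b ^ 2"
    by (simp add: F2_def Let_def algebra_simps power2_eq_square flip: b_def)
  also have "\<dots> = 4 * (a ^ 2 * (a + 2) * (a ^ 2 + 4 * a + 8))"
    unfolding zw unfolding b c by (simp add: algebra_simps power2_eq_square)
  finally show ?thesis
    using four by (simp add: z_def)
qed

lemma fract_const_neq_0: "p \<noteq> 0 \<Longrightarrow> Fraction_Field.Fract p 1 \<noteq> (0 :: ratfun)"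
  by (simp add: Zero_fract_def eq_fract)

lemma numeral_ratfun: "(numeral n :: ratfun) = Fraction_Field.Fract (numeral n) 1"
  by (metis of_nat_fract of_nat_numeral)

lemma phi_num_Ca:
  "phi_num a_rf = [:- z_of a_rf, 1:] ^ 2 * g3 a_rf" and "degree (g3 a_rf) = 3"
proof -
  have 1: "(2 :: ratfun) \<noteq> 0" 
    unfolding numeral_ratfun by (rule fract_const_neq_0) simp
  have 2: "2 * a_rf + 1 \<noteq> 0"
    unfolding numeral_ratfun a_rf_def One_fract_def
    by simp (rule fract_const_neq_0, simp add: numeral_poly one_pCons)
  have 3: "a_rf \<noteq> 0"
    unfolding a_rf_def by (rule fract_const_neq_0) simp
  have 4: "a_rf + 2 \<noteq> 0"
    unfolding numeral_ratfun a_rf_def 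
    by simp (rule fract_const_neq_0, simp add: numeral_poly one_pCons)
  have 5: "a_rf ^ 2 + 4 * a_rf + 8 \<noteq> 0"
    unfolding numeral_ratfun a_rf_def power2_eq_square
    by simp (rule fract_const_neq_0, simp add: numeral_poly one_pCons)
  have "poly (F2 a_rf) (z_of a_rf) \<noteq> 0"
    using poly_F2_z[OF 1 2] 3 4 5 by auto
  then show "phi_num a_rf = [:- z_of a_rf, 1:] ^ 2 * g3 a_rf" "degree (g3 a_rf) = 3"
    using phi_num_eq[OF 1 2] by auto
qed
end

theory Submission
  imports Defs
begin

text \<open>
  The parameter \<open>a\<close> meets almost every curve of the family twice: with \<open>c = a / 2\<close>, replacing
  \<open>c\<close> by \<open>1 / c\<close> reverses the coefficients of the sextic of \<open>C\<^sub>a\<close> up to a common factor. Hence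
  the absolute invariants are rational functions of \<open>y = (c - 1)\<^sup>2 / c\<close>, the quotient
  coordinate of this involution, and \<open>\<complex>(T) = \<complex>(y)\<close> because \<open>T = y / (25 (y + 4))\<close>. The
  inclusion of \<open>\<complex>(\<Y>\<^sub>1)\<close> in \<open>\<complex>(T)\<close> is an explicit form of this: the sextic has roots \<open>0\<close> and
  \<open>\<infinity>\<close>, and the invariants of such a sextic are polynomials in four isobaric expressions in its
  coefficients that are symmetric under reversal (\<open>J2_quintic\<close> to \<open>J10_quintic\<close>). Up to
  powers of \<open>c\<close>, these four are polynomials in \<open>y\<close> (\<open>quintic_C_symmetric_functions\<close>).

  For the converse one has to show that \<open>y \<mapsto> (i\<^sub>1, i\<^sub>3)\<close> is generically injective. It suffices
  to find one fibre that consists of a single reduced point, and the degenerations of the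
  family provide it. The discriminant factors completely, and up to a constant \<open>i\<^sub>3\<close> is
  \<open>y (y + 4)\<^sup>7 (4 y + 25)\<^sup>5 (2 y\<^sup>2 + 14 y + 25)\<^sup>5\<close> over the fifth power of a polynomial of
  degree 6. So \<open>i\<^sub>3\<close> has a simple zero at \<open>y = 0\<close>, and at its other zeros, including \<open>y = \<infinity>\<close>,
  the invariant \<open>i\<^sub>1\<close> takes values different from \<open>i\<^sub>1(0)\<close>.

  Algebraically, let \<open>K\<close> be the field generated by the invariants and \<open>g\<close> the minimal
  polynomial of \<open>y\<close> over \<open>K\<close>. It divides the two polynomials over \<open>K\<close> that express \<open>i\<^sub>1\<close> and
  \<open>i\<^sub>3\<close> through \<open>y\<close>. By Gauss's lemma this divisibility already holds over \<open>\<complex>[a]\<close>, so that it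
  can be specialised at \<open>a = 2\<close>, where \<open>y = 0\<close>. There the two polynomials have only the simple
  common root \<open>0\<close>, whence \<open>g\<close> has degree 1 and \<open>y\<close> lies in \<open>K\<close>
  (\<open>mem_subfield_of_simple_fibre\<close>, \<open>common_divisor_fibre\<close>).
\<close>


section \<open>Resultants as determinants of Bezout matrices\<close>

text \<open>
  The transpose of the Sylvester matrix of two polynomials of formal degree \<open>n\<close> consists of
  four triangular Toeplitz blocks. The two lower ones represent multiplication modulo \<open>X\<^sup>n\<close>
  and hence commute, which reduces the size of the determinant from \<open>2 n\<close> to \<open>n\<close>.
\<close>

lemma resultant_sub_eq_det_bezout:
  fixes p q :: "'a::idom poly"
  shows "resultant_sub n n p q = det (mat n n (\<lambda>(i, j). \<Sum>k\<le>min i j.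
    coeff q (i - k) * coeff p (n + k - j) - coeff p (i - k) * coeff q (n + k - j)))"
proof -
  define U where "U r = mat n n (\<lambda>(i, j). if i \<le> j then coeff r (n + i - j) else 0)"
    for r :: "'a poly"
  define L where "L r = mat n n (\<lambda>(i, j). if j \<le> i then coeff r (i - j) else 0)" for r :: "'a poly"
  have carrier: "U r \<in> carrier_mat n n" "L r \<in> carrier_mat n n" for r
    by (simp_all add: U_def L_def)
  have L_mult: "L r * L s = mat n n (\<lambda>(i, j). if j \<le> i then coeff (r * s) (i - j) else 0)" for r s
  proof (rule eq_matI)
    fix i j
    assume "i < dim_row (mat n n (\<lambda>(i, j). if j \<le> i then coeff (r * s) (i - j) else 0))"
      "j < dim_col (mat n n (\<lambda>(i, j). if j \<le> i then coeff (r * s) (i - j) else 0))"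
    then have ij: "i < n" "j < n" by simp_all
    have "(L r * L s) $$ (i, j) =
      (\<Sum>k\<in>{0..<n}. if j \<le> k \<and> k \<le> i then coeff r (i - k) * coeff s (k - j) else 0)"
      using ij by (auto simp: L_def scalar_prod_def intro!: sum.cong)
    also have "\<dots> = (\<Sum>k\<in>{j..i}. coeff r (i - k) * coeff s (k - j))"
      using ij by (intro sum.mono_neutral_cong_right) auto
    also have "\<dots> = (if j \<le> i then coeff (r * s) (i - j) else 0)"
    proof (cases "j \<le> i")
      case True
      have "(\<Sum>k\<in>{j..i}. coeff r (i - k) * coeff s (k - j)) =
        (\<Sum>k\<le>i - j. coeff r k * coeff s (i - j - k))"
        by (rule sum.reindex_bij_witness[where i="\<lambda>k. i - k" and j="\<lambda>k. i - k"]) (use True in auto)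
      then show ?thesis using True by (simp add: coeff_mult)
    qed simp
    finally show "(L r * L s) $$ (i, j) =
      mat n n (\<lambda>(i, j). if j \<le> i then coeff (r * s) (i - j) else 0) $$ (i, j)"
      using ij by simp
  qed (simp_all add: L_def)
  have commute: "L p * L q = L q * L p"
    unfolding L_mult by (simp only: mult.commute[of p q])
  have carrier_mult: "L r * U s \<in> carrier_mat n n" for r s
    using carrier by (rule_tac mult_carrier_mat)
  have LU: "(L r * U s) $$ (i, j) = (\<Sum>k\<le>min i j. coeff r (i - k) * coeff s (n + k - j))"
    if "i < n" "j < n" for i j r s
  proof -
    have "(L r * U s) $$ (i, j) =
      (\<Sum>k\<in>{0..<n}. if k \<le> i \<and> k \<le> j then coeff r (i - k) * coeff s (n + k - j) else 0)"
      using that by (auto simp: L_def U_def scalar_prod_def intro!: sum.cong)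
    also have "\<dots> = (\<Sum>k\<le>min i j. coeff r (i - k) * coeff s (n + k - j))"
      using that by (intro sum.mono_neutral_cong_right) auto
    finally show ?thesis .
  qed
  have "sylvester_mat_sub n n p q = four_block_mat (U p) (L p) (U q) (L q)"
    by (rule eq_matI)
      (auto simp: sylvester_mat_sub_index U_def L_def four_block_mat_def Let_def not_less,
        simp_all add: add.commute)
  then have "resultant_sub n n p q =
    det (transpose_mat (four_block_mat (U p) (L p) (U q) (L q)))"
    unfolding resultant_sub_def using carrier
    by (subst det_transpose[of _ "n + n"]) (auto intro: four_block_carrier_mat)
  also have "transpose_mat (four_block_mat (U p) (L p) (U q) (L q)) =
    four_block_mat (transpose_mat (U p)) (transpose_mat (U q))
      (transpose_mat (L p)) (transpose_mat (L q))"
    using carrier by (intro transpose_four_block_mat)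
  also have "det \<dots> = det (transpose_mat (U p) * transpose_mat (L q)
      - transpose_mat (U q) * transpose_mat (L p))"
    using carrier transpose_mult[of "L p" n n "L q" n] transpose_mult[of "L q" n n "L p" n] commute
    by (intro det_four_block_mat) auto
  also have "\<dots> = det (transpose_mat (L q * U p - L p * U q))"
    using carrier transpose_mult[of "L q" n n "U p" n] transpose_mult[of "L p" n n "U q" n]
      transpose_minus[OF carrier_mult carrier_mult]
    by simp
  also have "\<dots> = det (L q * U p - L p * U q)"
    using carrier_mult by (intro det_transpose[of _ n] minus_carrier_mat) auto
  also have "L q * U p - L p * U q = mat n n (\<lambda>(i, j). \<Sum>k\<le>min i j.
    coeff q (i - k) * coeff p (n + k - j) - coeff p (i - k) * coeff q (n + k - j))"
    using carrier_matD[OF carrier_mult]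
    by (intro eq_matI) (simp_all add: LU sum_subtractf del: index_mult_mat)
  finally show ?thesis .
qed

text \<open>
  The column that remains in position \<open>k\<close> when column \<open>j\<close> is deleted. Recursive equations,
  unlike a case distinction \<open>k < j\<close>, can be evaluated by rewriting once \<open>j\<close> and \<open>k\<close> are known.
\<close>

fun skip :: "nat \<Rightarrow> nat \<Rightarrow> nat" where
  "skip 0 k = Suc k"
| "skip (Suc j) 0 = 0"
| "skip (Suc j) (Suc k) = Suc (skip j k)"

lemma skip_eq: "skip j k = (if k < j then k else Suc k)"
  by (induction j k rule: skip.induct) auto

lemma det_mat_Suc:
  fixes f :: "nat \<times> nat \<Rightarrow> 'a::comm_ring_1"
  shows "det (mat (Suc n) (Suc n) f) =
    (\<Sum>j<Suc n. (-1) ^ j * f (0, j) * det (mat n n (\<lambda>(i, k). f (Suc i, skip j k))))"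
proof -
  have "mat_delete (mat (Suc n) (Suc n) f) 0 j = mat n n (\<lambda>(i, k). f (Suc i, skip j k))"
    for j by (rule eq_matI) (auto simp: mat_delete_def skip_eq)
  then show ?thesis
    by (subst laplace_expansion_row[of _ "Suc n" 0]) (auto simp: cofactor_def intro!: sum.cong)
qed


section \<open>Igusa invariants of a sextic with roots 0 and infinity\<close>

text \<open>
  The substitutions \<open>x \<mapsto> t x\<close> and \<open>x \<mapsto> 1 / x\<close> preserve the pair of roots \<open>0\<close>, \<open>\<infinity>\<close>. The
  expressions \<open>P\<close>, \<open>Q\<close>, \<open>a3\<close> and \<open>V\<close> are invariant under both of them up to powers of \<open>t\<close>, and
  the Igusa invariants are polynomials in these four.
\<close>

context
  fixes a1 a2 a3 a4 a5 P Q V :: "'a::field" and f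
  assumes f_def: "f = [:0, a1, a2, a3, a4, a5:]"
    and P_def: "P = a1 * a5" and Q_def: "Q = a2 * a4" and V_def: "V = a1 * a4 ^ 2 + a2 ^ 2 * a5"
begin

lemma coeff_f:
  "coeff f 0 = 0" "coeff f 1 = a1" "coeff f 2 = a2" "coeff f 3 = a3"
  "coeff f 4 = a4" "coeff f 5 = a5"
  "coeff f 6 = 0" "coeff f (Suc 0) = a1"
  by (simp_all add: f_def eval_nat_numeral)

lemma J2_quintic: "J2 f = 40 * P + 6 * a3 ^ 2 - 16 * Q"
  by (simp add: J2_def coeff_f P_def Q_def)

lemma J4_quintic: "J4 f = - 80 * P ^ 2 + 4 * P * Q + 36 * P * a3 ^ 2 - 12 * a3 * V + 4 * Q ^ 2"
  by (simp add: J4_def coeff_f P_def Q_def V_def) Groebner_Basis.algebra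

lemma J6_quintic: "J6 f = - 320 * P ^ 3 + 64 * P ^ 2 * Q + 176 * P ^ 2 * a3 ^ 2 + 26 * a3 * P * V
    - 36 * (V ^ 2 - 2 * P * Q ^ 2) + 28 * P * Q ^ 2 - 238 * P * Q * a3 ^ 2 + 76 * a3 * Q * V
    + 72 * P * a3 ^ 4 - 24 * a3 ^ 3 * V - 24 * Q ^ 3 + 8 * Q ^ 2 * a3 ^ 2"
  by (simp add: J6_def coeff_f P_def Q_def V_def) Groebner_Basis.algebra

text \<open>
  The second factor is the discriminant of the quartic \<open>a1 + a2 X + a3 X\<^sup>2 + a4 X\<^sup>3 + a5 X\<^sup>4\<close>,
  and \<open>P\<^sup>2\<close> is the product of its squared resultants with the two linear forms at \<open>0\<close> and \<open>\<infinity>\<close>.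
\<close>

lemma J10_quintic:
  assumes "6 \<noteq> (0::'a)"
  shows "J10 f = P ^ 2 * (256 * P ^ 3 - 192 * P ^ 2 * Q - 128 * P ^ 2 * a3 ^ 2 + 144 * a3 * P * V
    - 27 * (V ^ 2 - 2 * P * Q ^ 2) - 6 * P * Q ^ 2 - 80 * P * Q * a3 ^ 2 + 18 * a3 * Q * V
    + 16 * P * a3 ^ 4 - 4 * a3 ^ 3 * V - 4 * Q ^ 3 + Q ^ 2 * a3 ^ 2)" (is "_ = P ^ 2 * ?D")
proof -
  define p where "p = pderiv f"
  define q where "q = Polynomial.smult 6 f - [:0, 1:] * p"
  have p: "p = [:a1, 2 * a2, 3 * a3, 4 * a4, 5 * a5:]"
    by (simp add: p_def f_def pderiv_pCons)
  have q: "q = [:0, 5 * a1, 4 * a2, 3 * a3, 2 * a4, a5:]"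
    by (simp add: q_def p f_def)
  have "resultant_sub 5 5 p q = - (6 ^ 4 * (P ^ 2 * ?D))"
    unfolding resultant_sub_eq_det_bezout p q P_def Q_def V_def
    by (simp add: numeral_eq_Suc det_mat_Suc atMost_Suc) Groebner_Basis.algebra
  then have "J10 f = 6 ^ 4 * (P ^ 2 * ?D) / 6 ^ 4"
    by (simp only: J10_def p_def q_def minus_minus)
  also have "\<dots> = P ^ 2 * ?D"
    by (rule nonzero_mult_div_cancel_left) (rule power_not_zero[OF assms])
  finally show ?thesis .
qed

end


section \<open>The sextics of the family in the parameter \<open>a / 2\<close>\<close>

text \<open>
  The parameter \<open>c = a / 2\<close> makes the symmetry visible:
  \<open>quintic_coeff5 (1 / c) * c ^ 12 = quintic_coeff1 c\<close>, likewise for the coefficients 4 and 2,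
  and \<open>quintic_coeff3\<close> is palindromic.
\<close>

definition quintic_coeff1 :: "'a::comm_ring_1 \<Rightarrow> 'a" where
  "quintic_coeff1 c =
    c ^ 7 * (4 + 17 * c + 36 * c ^ 2 + 40 * c ^ 3 + 24 * c ^ 4 + 4 * c ^ 5)"

definition quintic_coeff2 :: "'a::comm_ring_1 \<Rightarrow> 'a" where
  "quintic_coeff2 c =
    - (c ^ 4 * (4 + 8 * c + 58 * c ^ 2 + 160 * c ^ 3 + 146 * c ^ 4 + 64 * c ^ 5 + 32 * c ^ 6
    + 24 * c ^ 7 + 4 * c ^ 8))"

definition quintic_coeff3 :: "'a::comm_ring_1 \<Rightarrow> 'a" where
  "quintic_coeff3 c =
    c ^ 2 * (- 8 + 28 * c + 133 * c ^ 2 + 164 * c ^ 3 + 116 * c ^ 4 + 164 * c ^ 5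
    + 133 * c ^ 6 + 28 * c ^ 7 - 8 * c ^ 8)"

definition quintic_coeff4 :: "'a::comm_ring_1 \<Rightarrow> 'a" where
  "quintic_coeff4 c =
    - (4 + 24 * c + 32 * c ^ 2 + 64 * c ^ 3 + 146 * c ^ 4 + 160 * c ^ 5 + 58 * c ^ 6
    + 8 * c ^ 7 + 4 * c ^ 8)"

definition quintic_coeff5 :: "'a::comm_ring_1 \<Rightarrow> 'a" where
  "quintic_coeff5 c =
    4 + 24 * c + 40 * c ^ 2 + 36 * c ^ 3 + 17 * c ^ 4 + 4 * c ^ 5"

lemmas quintic_coeff_defs = quintic_coeff1_def quintic_coeff2_def quintic_coeff3_def
  quintic_coeff4_def quintic_coeff5_def

definition quintic_C :: "'a::field \<Rightarrow> 'a poly" where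
  "quintic_C c = [:0, quintic_coeff1 c, quintic_coeff2 c, quintic_coeff3 c, quintic_coeff4 c,
    quintic_coeff5 c:]"

text \<open>
  The cubic is found by clearing the denominators \<open>d\<close> of \<open>z\<close> and \<open>d\<^sup>3 e\<^sup>2\<close> of \<open>\<phi>(z)\<close>; the
  double root \<open>z\<close> can then be split off by a polynomial identity in \<open>c\<close>. The excluded values
  of \<open>c\<close> are those where \<open>z\<close> or \<open>\<phi>(z)\<close> has a vanishing denominator.
\<close>

lemma sextic_C_eq_smult_quintic:
  fixes c :: "'a::field"
  assumes nz: "2 \<noteq> (0::'a)" "c \<noteq> 0" "c + 1 \<noteq> 0" "4 * c + 1 \<noteq> 0" "c ^ 2 + 2 * c + 2 \<noteq> 0"
  shows "sextic_C (2 * c) =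
    Polynomial.smult (1 / ((4 * c + 1) * (c ^ 2 + 2 * c + 2) ^ 2)) (quintic_C c)"
proof -
  define a where "a = 2 * c"
  define z where "z = z_of a"
  define d where "d = 4 * c + 1"
  define e where "e = c ^ 2 + 2 * c + 2"
  define h where "h = 2 * c ^ 2 + 2 * c + 1"
  have d: "d \<noteq> 0" and e: "e \<noteq> 0" using nz by (simp_all add: d_def e_def)
  have four: "4 \<noteq> (0::'a)"
    using nz(1) by (metis mult_2_right mult_eq_0_iff numeral_Bit0)
  have b: "b_of a = c ^ 2"
  proof -
    have "b_of a = 4 * c ^ 2 / 4" by (simp add: b_of_def a_def power2_eq_square)
    then show ?thesis using four by (simp only: nonzero_mult_div_cancel_left not_False_eq_True)
  qed
  have zd: "z * d = c * (c + 4)"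
  proof -
    have "z = 4 * (c * (c + 4)) / (4 * d)"
      by (simp add: z_def z_of_def a_def d_def algebra_simps)
    then show ?thesis using four d
      by (simp only: mult_divide_mult_cancel_left not_False_eq_True) simp
  qed
  have F1: "F1 a = [:4 * c ^ 3 + c ^ 4, 4 * c + 6 * c ^ 2, 1:]"
    by (simp add: F1_def Let_def b) (simp add: a_def; Groebner_Basis.algebra)
  have F2: "F2 a = [:c ^ 4, 6 * c ^ 2 + 4 * c ^ 3, 4 * c + 1:]"
    by (simp add: F2_def Let_def b) (simp add: a_def; Groebner_Basis.algebra)
  have "d ^ 2 * poly (F1 a) z = (z * d) ^ 2 + (4 * c + 6 * c ^ 2) * d * (z * d)
      + d ^ 2 * (4 * c ^ 3 + c ^ 4)"
    unfolding F1 by simp Groebner_Basis.algebra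
  also have "\<dots> = 8 * c ^ 2 * (c + 1) * ((c + 4) * h)"
    unfolding zd unfolding d_def h_def by Groebner_Basis.algebra
  finally have A: "d ^ 2 * poly (F1 a) z = 8 * c ^ 2 * (c + 1) * ((c + 4) * h)" .
  have "d * (d * poly (F2 a) z)
      = d * (z * d) ^ 2 + (6 * c ^ 2 + 4 * c ^ 3) * d * (z * d) + d ^ 2 * c ^ 4"
    unfolding F2 d_def by simp Groebner_Basis.algebra
  also have "\<dots> = d * (8 * c ^ 2 * (c + 1) * e)"
    unfolding zd unfolding d_def e_def by Groebner_Basis.algebra
  finally have B: "d * poly (F2 a) z = 8 * c ^ 2 * (c + 1) * e" using d by simp
  define \<phi> where "\<phi> = phi a z"
  have phi: "d ^ 3 * e ^ 2 * \<phi> = c * (c + 4) ^ 3 * h ^ 2"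
  proof -
    define k where "k = 8 * c ^ 2 * (c + 1)"
    have "(2::'a) ^ 3 \<noteq> 0" using nz(1) by (rule power_not_zero)
    then have k: "k \<noteq> 0" using nz by (simp add: k_def)
    have "poly (F2 a) z \<noteq> 0" using B k e by (auto simp: k_def)
    then have "\<phi> * poly (F2 a) z ^ 2 = z * poly (F1 a) z ^ 2"
      by (simp add: \<phi>_def phi_def)
    then have "d ^ 3 * \<phi> * (d * poly (F2 a) z) ^ 2 = (z * d) * (d ^ 2 * poly (F1 a) z) ^ 2"
      by Groebner_Basis.algebra
    then have "k ^ 2 * (d ^ 3 * e ^ 2 * \<phi>) = k ^ 2 * (c * (c + 4) ^ 3 * h ^ 2)"
      unfolding zd A B k_def by Groebner_Basis.algebra
    then show ?thesis using k by simp
  qed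
  define l where "l = [:- z, 1:]"
  define G where "G = [:- (c ^ 7 * (c + 4) * h ^ 2),
    c ^ 4 * (4 + 8 * c + 58 * c ^ 2 + 156 * c ^ 3 + 129 * c ^ 4 + 28 * c ^ 5 - 8 * c ^ 6),
    c ^ 2 * (8 - 28 * c - 129 * c ^ 2 - 156 * c ^ 3 - 58 * c ^ 4 - 8 * c ^ 5 - 4 * c ^ 6),
    d * e ^ 2:]"
  have "Polynomial.smult (d ^ 3 * e ^ 2) (phi_num a) =
    Polynomial.smult (d ^ 3 * e ^ 2) ([:0, 1:] * F1 a ^ 2)
    - Polynomial.smult (d ^ 3 * e ^ 2 * \<phi>) (F2 a ^ 2)"
    by (simp add: phi_num_def smult_diff_right \<phi>_def z_def)
  also have "\<dots> = [:- (z * d), d:] ^ 2 * G"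
    unfolding phi unfolding F1 F2 G_def zd power2_eq_square unfolding d_def e_def h_def
    by simp (intro conjI; Groebner_Basis.algebra)
  also have "[:- (z * d), d:] = Polynomial.smult d l"
    by (simp add: l_def mult.commute)
  also have "Polynomial.smult d l ^ 2 * G =
      Polynomial.smult (d ^ 3 * e ^ 2) (l ^ 2 * Polynomial.smult (1 / (d * e ^ 2)) G)"
    using d e by (simp add: smult_power power2_eq_square power3_eq_cube)
  finally have "phi_num a = l ^ 2 * Polynomial.smult (1 / (d * e ^ 2)) G"
    using smult_cancel[of "d ^ 3 * e ^ 2"] d e by simp
  then have "g3 a = Polynomial.smult (1 / (d * e ^ 2)) G"
    by (simp add: g3_def l_def z_def del: mult_pCons_left mult_smult_right)
  then have "sextic_C a = Polynomial.smult (1 / (d * e ^ 2)) ([:0, 1:] * [:- 1, 1:] * G)"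
    by (simp add: sextic_C_def del: mult_pCons_left)
  also have "[:0, 1:] * [:- 1, 1:] * G = quintic_C c"
    unfolding G_def quintic_C_def quintic_coeff_defs d_def e_def h_def
    by simp (intro conjI; Groebner_Basis.algebra)
  finally show ?thesis by (simp only: a_def d_def e_def)
qed


section \<open>The invariants as functions of the quotient coordinate\<close>

text \<open>
  The four weight-normalised expressions for \<open>quintic_C c\<close>, as polynomials in
  \<open>y = (c - 1)\<^sup>2 / c\<close>: the products of opposite coefficients, the middle coefficient, and
  \<open>a\<^sub>1 a\<^sub>4\<^sup>2 + a\<^sub>2\<^sup>2 a\<^sub>5\<close>.
\<close>

definition prod15_y :: "'a::comm_ring_1 \<Rightarrow> 'a" where
  "prod15_y y = 15625 + 20000 * y + 10200 * y ^ 2 + 2584 * y ^ 3 + 324 * y ^ 4 + 16 * y ^ 5"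

definition prod24_y :: "'a::comm_ring_1 \<Rightarrow> 'a" where
  "prod24_y y = 250000 + 490000 * y + 476100 * y ^ 2 + 272656 * y ^ 3 + 100064 * y ^ 4
    + 24656 * y ^ 5 + 4008 * y ^ 6 + 384 * y ^ 7 + 16 * y ^ 8"

definition coeff3_y :: "'a::comm_ring_1 \<Rightarrow> 'a" where
  "coeff3_y y = 750 + 820 * y + 141 * y ^ 2 - 36 * y ^ 3 - 8 * y ^ 4"

definition mixed_y :: "'a::comm_ring_1 \<Rightarrow> 'a" where
  "mixed_y y = 62500000 + 162500000 * y + 205025000 * y ^ 2 + 167732000 * y ^ 3
    + 97709920 * y ^ 4 + 41553088 * y ^ 5 + 12856736 * y ^ 6 + 2841984 * y ^ 7 + 434208 * y ^ 8
    + 43264 * y ^ 9 + 2512 * y ^ 10 + 64 * y ^ 11"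

lemmas y_poly_defs = prod15_y_def prod24_y_def coeff3_y_def mixed_y_def

text \<open>
  The right hand sides are homogenised in \<open>c * y\<close> and \<open>c\<close>, so that substituting \<open>(c - 1)\<^sup>2\<close>
  for \<open>c * y\<close> leaves polynomial identities in \<open>c\<close> alone.
\<close>

lemma quintic_C_symmetric_functions:
  fixes c y :: "'a::field"
  assumes y: "c * y = (c - 1) ^ 2"
  shows "quintic_coeff1 c * quintic_coeff5 c = c ^ 12 * prod15_y y"
    and "quintic_coeff2 c * quintic_coeff4 c = c ^ 12 * prod24_y y"
    and "quintic_coeff3 c = c ^ 6 * coeff3_y y"
    and "quintic_coeff1 c * quintic_coeff4 c ^ 2 + quintic_coeff2 c ^ 2 * quintic_coeff5 c
      = c ^ 18 * mixed_y y"
proof -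
  have "c ^ 12 * prod15_y y = c ^ 7 * (15625 * c ^ 5 + 20000 * (c * y) * c ^ 4
      + 10200 * (c * y) ^ 2 * c ^ 3 + 2584 * (c * y) ^ 3 * c ^ 2 + 324 * (c * y) ^ 4 * c
      + 16 * (c * y) ^ 5)"
    unfolding prod15_y_def by Groebner_Basis.algebra
  then show "quintic_coeff1 c * quintic_coeff5 c = c ^ 12 * prod15_y y"
    unfolding y quintic_coeff_defs by Groebner_Basis.algebra
  have "c ^ 12 * prod24_y y = c ^ 4 * (250000 * c ^ 8 + 490000 * (c * y) * c ^ 7
      + 476100 * (c * y) ^ 2 * c ^ 6 + 272656 * (c * y) ^ 3 * c ^ 5
      + 100064 * (c * y) ^ 4 * c ^ 4 + 24656 * (c * y) ^ 5 * c ^ 3 + 4008 * (c * y) ^ 6 * c ^ 2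
      + 384 * (c * y) ^ 7 * c + 16 * (c * y) ^ 8)"
    unfolding prod24_y_def by Groebner_Basis.algebra
  then show "quintic_coeff2 c * quintic_coeff4 c = c ^ 12 * prod24_y y"
    unfolding y quintic_coeff_defs by Groebner_Basis.algebra
  have "c ^ 6 * coeff3_y y = c ^ 2 * (750 * c ^ 4 + 820 * (c * y) * c ^ 3
      + 141 * (c * y) ^ 2 * c ^ 2 - 36 * (c * y) ^ 3 * c - 8 * (c * y) ^ 4)"
    unfolding coeff3_y_def by Groebner_Basis.algebra
  then show "quintic_coeff3 c = c ^ 6 * coeff3_y y"
    unfolding y quintic_coeff_defs by Groebner_Basis.algebra
  have "c ^ 18 * mixed_y y = c ^ 7 * (62500000 * c ^ 11 + 162500000 * (c * y) * c ^ 10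
      + 205025000 * (c * y) ^ 2 * c ^ 9 + 167732000 * (c * y) ^ 3 * c ^ 8
      + 97709920 * (c * y) ^ 4 * c ^ 7 + 41553088 * (c * y) ^ 5 * c ^ 6
      + 12856736 * (c * y) ^ 6 * c ^ 5 + 2841984 * (c * y) ^ 7 * c ^ 4
      + 434208 * (c * y) ^ 8 * c ^ 3 + 43264 * (c * y) ^ 9 * c ^ 2 + 2512 * (c * y) ^ 10 * c
      + 64 * (c * y) ^ 11)"
    unfolding mixed_y_def by Groebner_Basis.algebra
  then show "quintic_coeff1 c * quintic_coeff4 c ^ 2 + quintic_coeff2 c ^ 2 * quintic_coeff5 c
      = c ^ 18 * mixed_y y"
    unfolding y quintic_coeff_defs by Groebner_Basis.algebra
qed

text \<open>
  The nontrivial factors of \<open>J\<^sub>2\<close>, \<open>J\<^sub>4\<close> and \<open>J\<^sub>1\<^sub>0\<close>, written as binary forms in numerator and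
  denominator of \<open>y\<close>. The form \<open>j10_form\<close> collects what survives of \<open>J\<^sub>1\<^sub>0\<close> when the factor
  \<open>(y (y + 4))\<^sup>5\<close> that it shares with \<open>J\<^sub>2\<^sup>5\<close> is removed.
\<close>

definition j2_form :: "'a::comm_ring_1 \<Rightarrow> 'a \<Rightarrow> 'a" where
  "j2_form u v = 42500 * v ^ 6 - 248900 * u * v ^ 5 - 337237 * u ^ 2 * v ^ 4
    - 152568 * u ^ 3 * v ^ 3 - 28544 * u ^ 4 * v ^ 2 - 1600 * u ^ 5 * v + 64 * u ^ 6"

definition j4_form :: "'a::comm_ring_1 \<Rightarrow> 'a \<Rightarrow> 'a" where
  "j4_form u v = - 412109375 * v ^ 12 - 1116875000 * u * v ^ 11 - 120300000 * u ^ 2 * v ^ 10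
    + 1660903000 * u ^ 3 * v ^ 9 + 2074932020 * u ^ 4 * v ^ 8 + 1297538800 * u ^ 5 * v ^ 7
    + 508429344 * u ^ 6 * v ^ 6 + 134080192 * u ^ 7 * v ^ 5 + 24331472 * u ^ 8 * v ^ 4
    + 3013888 * u ^ 9 * v ^ 3 + 244608 * u ^ 10 * v ^ 2 + 11776 * u ^ 11 * v + 256 * u ^ 12"

definition j10_form :: "'a::comm_ring_1 \<Rightarrow> 'a \<Rightarrow> 'a" where
  "j10_form u v = u * (u + 4 * v) ^ 7 * (4 * u + 25 * v) ^ 5
    * (2 * u ^ 2 + 14 * u * v + 25 * v ^ 2) ^ 5"

definition j6_y :: "'a::comm_ring_1 \<Rightarrow> 'a" where
  "j6_y y = (let P = prod15_y y; Q = prod24_y y; a3 = coeff3_y y; V = mixed_y y in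
    - 320 * P ^ 3 + 64 * P ^ 2 * Q + 176 * P ^ 2 * a3 ^ 2 + 26 * a3 * P * V
    - 36 * (V ^ 2 - 2 * P * Q ^ 2) + 28 * P * Q ^ 2 - 238 * P * Q * a3 ^ 2 + 76 * a3 * Q * V
    + 72 * P * a3 ^ 4 - 24 * a3 ^ 3 * V - 24 * Q ^ 3 + 8 * Q ^ 2 * a3 ^ 2)"

lemma j2_y_factored:
  fixes y :: "'a::field"
  shows "40 * prod15_y y + 6 * coeff3_y y ^ 2 - 16 * prod24_y y = 2 * y * (y + 4) * j2_form y 1"
  unfolding y_poly_defs j2_form_def power_one mult_1_right by Groebner_Basis.algebra

lemma j4_y_factored:
  fixes y :: "'a::field"
  shows "- 80 * prod15_y y ^ 2 + 4 * prod15_y y * prod24_y y + 36 * prod15_y y * coeff3_y y ^ 2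
    - 12 * coeff3_y y * mixed_y y + 4 * prod24_y y ^ 2 = 4 * y ^ 2 * (y + 4) ^ 2 * j4_form y 1"
  unfolding y_poly_defs j4_form_def power_one mult_1_right by Groebner_Basis.algebra

lemma disc_y_factored:
  fixes y :: "'a::field"
  defines "P \<equiv> prod15_y y" and "Q \<equiv> prod24_y y" and "V \<equiv> mixed_y y" and "a3 \<equiv> coeff3_y y"
  shows "256 * P ^ 3 - 192 * P ^ 2 * Q - 128 * P ^ 2 * a3 ^ 2 + 144 * a3 * P * V
    - 27 * (V ^ 2 - 2 * P * Q ^ 2) - 6 * P * Q ^ 2 - 80 * P * Q * a3 ^ 2 + 18 * a3 * Q * V
    + 16 * P * a3 ^ 4 - 4 * a3 ^ 3 * V - 4 * Q ^ 3 + Q ^ 2 * a3 ^ 2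
    = - 2048 * y ^ 6 * (y + 4) ^ 12 * (4 * y + 25) ^ 3 * (2 * y ^ 2 + 14 * y + 25)"
  unfolding P_def Q_def V_def a3_def y_poly_defs by Groebner_Basis.algebra

lemma prod15_y_factored:
  fixes y :: "'a::field"
  shows "prod15_y y = (4 * y + 25) * (2 * y ^ 2 + 14 * y + 25) ^ 2"
  unfolding prod15_y_def by Groebner_Basis.algebra

text \<open>
  The factor \<open>k\<close> of the quintic and the power of \<open>c\<close> from the weights enter only through \<open>m\<close>,
  with exponent the degree of the invariant.
\<close>

lemma igusa_invariants_quintic_C:
  fixes c y k :: "'a::field_char_0"
  assumes y: "c * y = (c - 1) ^ 2"
  defines "f \<equiv> Polynomial.smult k (quintic_C c)" and "m \<equiv> k * c ^ 6"
  shows "J2 f = m ^ 2 * (2 * y * (y + 4) * j2_form y 1)"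
    and "J4 f = m ^ 4 * (4 * y ^ 2 * (y + 4) ^ 2 * j4_form y 1)"
    and "J6 f = m ^ 6 * j6_y y"
    and "J10 f = - 2048 * m ^ 10 * (y ^ 5 * (y + 4) ^ 5 * j10_form y 1)"
proof -
  define P Q a3 V
    where "P = prod15_y y" and "Q = prod24_y y" and "a3 = coeff3_y y" and "V = mixed_y y"
  note defs = P_def Q_def a3_def V_def
  obtain a1 a2 a4 a5 where f: "f = [:0, a1, a2, m * a3, a4, a5:]"
    and P: "m ^ 2 * P = a1 * a5" and Q: "m ^ 2 * Q = a2 * a4"
    and V: "m ^ 3 * V = a1 * a4 ^ 2 + a2 ^ 2 * a5"
  proof -
    obtain b1 b2 b3 b4 b5 where b: "quintic_C c = [:0, b1, b2, b3, b4, b5:]"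
      and *: "b1 * b5 = c ^ 12 * P" "b2 * b4 = c ^ 12 * Q" "b3 = c ^ 6 * a3"
        "b1 * b4 ^ 2 + b2 ^ 2 * b5 = c ^ 18 * V"
      unfolding quintic_C_def defs using quintic_C_symmetric_functions[OF y] by blast
    have "f = [:0, k * b1, k * b2, m * a3, k * b4, k * b5:]"
      by (simp add: f_def b * m_def)
    moreover have "m ^ 2 * P = (k * b1) * (k * b5)" "m ^ 2 * Q = (k * b2) * (k * b4)"
      unfolding m_def using * by Groebner_Basis.algebra+
    moreover have "m ^ 3 * V = (k * b1) * (k * b4) ^ 2 + (k * b2) ^ 2 * (k * b5)"
      unfolding m_def using * by Groebner_Basis.algebra
    ultimately show ?thesis by (rule that)
  qed
  have "J2 f = m ^ 2 * (40 * P + 6 * a3 ^ 2 - 16 * Q)"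
    unfolding J2_quintic[OF f P Q V] by Groebner_Basis.algebra
  then show "J2 f = m ^ 2 * (2 * y * (y + 4) * j2_form y 1)"
    by (simp only: defs j2_y_factored)
  have "J4 f = m ^ 4 * (- 80 * P ^ 2 + 4 * P * Q + 36 * P * a3 ^ 2 - 12 * a3 * V + 4 * Q ^ 2)"
    unfolding J4_quintic[OF f P Q V] by Groebner_Basis.algebra
  then show "J4 f = m ^ 4 * (4 * y ^ 2 * (y + 4) ^ 2 * j4_form y 1)"
    by (simp only: defs j4_y_factored)
  show "J6 f = m ^ 6 * j6_y y"
    unfolding J6_quintic[OF f P Q V] j6_y_def Let_def defs [symmetric] by Groebner_Basis.algebra
  have "J10 f = m ^ 10 * (P ^ 2 *
    (256 * P ^ 3 - 192 * P ^ 2 * Q - 128 * P ^ 2 * a3 ^ 2 + 144 * a3 * P * V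
    - 27 * (V ^ 2 - 2 * P * Q ^ 2) - 6 * P * Q ^ 2 - 80 * P * Q * a3 ^ 2 + 18 * a3 * Q * V
    + 16 * P * a3 ^ 4 - 4 * a3 ^ 3 * V - 4 * Q ^ 3 + Q ^ 2 * a3 ^ 2))"
    by (subst J10_quintic[OF f P Q V]) (simp, Groebner_Basis.algebra)
  also have "\<dots> = - 2048 * m ^ 10 * (y ^ 5 * (y + 4) ^ 5 * j10_form y 1)"
    unfolding defs disc_y_factored unfolding prod15_y_factored j10_form_def mult_1_right power_one
    by Groebner_Basis.algebra
  finally show "J10 f = - 2048 * m ^ 10 * (y ^ 5 * (y + 4) ^ 5 * j10_form y 1)" .
qed

text \<open>
  The scaling factor \<open>m\<close> of the previous lemma cancels, and so does \<open>c\<close>: the right hand sides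
  depend on \<open>y\<close> only.
\<close>

lemma absolute_invariants_C:
  fixes c y :: "'a::field_char_0"
  assumes nz: "c \<noteq> 0" "c \<noteq> 1" "c + 1 \<noteq> 0" "4 * c + 1 \<noteq> 0" "c ^ 2 + 2 * c + 2 \<noteq> 0"
  defines "y \<equiv> (c - 1) ^ 2 / c"
  defines "A \<equiv> 2 * y * (y + 4) * j2_form y 1" and "B \<equiv> 4 * y ^ 2 * (y + 4) ^ 2 * j4_form y 1"
  shows "i1 (sextic_C (2 * c)) = 144 * j4_form y 1 / j2_form y 1 ^ 2"
    and "i2 (sextic_C (2 * c)) = - 1728 * (A * B - 3 * j6_y y) / A ^ 3"
    and "i3 (sextic_C (2 * c)) = - 31104 * j10_form y 1 / j2_form y 1 ^ 5"
proof -
  define k where "k = 1 / ((4 * c + 1) * (c ^ 2 + 2 * c + 2) ^ 2)"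
  define m where "m = k * c ^ 6"
  have m: "m \<noteq> 0" using nz by (simp add: m_def k_def)
  have y: "c * y = (c - 1) ^ 2" using nz by (simp add: y_def)
  have y4: "c * (y + 4) = (c + 1) ^ 2" using y by (simp add: power2_eq_square algebra_simps)
  have y_nz: "y \<noteq> 0" "y + 4 \<noteq> 0" using y y4 nz by auto
  have f: "sextic_C (2 * c) = Polynomial.smult k (quintic_C c)"
    unfolding k_def by (rule sextic_C_eq_smult_quintic) (use nz in auto)
  note J = igusa_invariants_quintic_C[OF y, of k, folded f m_def]
  have J': "J2 (sextic_C (2 * c)) = m ^ 2 * A" "J4 (sextic_C (2 * c)) = m ^ 4 * B"
    unfolding A_def B_def by (rule J)+
  have "i1 (sextic_C (2 * c)) = (4 * m ^ 4 * y ^ 2 * (y + 4) ^ 2) * (144 * j4_form y 1)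
      / ((4 * m ^ 4 * y ^ 2 * (y + 4) ^ 2) * j2_form y 1 ^ 2)"
    unfolding i1_def J' A_def B_def by (rule arg_cong2[where f = "(/)"]) Groebner_Basis.algebra+
  also have "\<dots> = 144 * j4_form y 1 / j2_form y 1 ^ 2"
    by (rule mult_divide_mult_cancel_left) (use y_nz m in simp)
  finally show "i1 (sextic_C (2 * c)) = 144 * j4_form y 1 / j2_form y 1 ^ 2" .
  have "i2 (sextic_C (2 * c)) = m ^ 6 * (- 1728 * (A * B - 3 * j6_y y)) / (m ^ 6 * A ^ 3)"
    unfolding i2_def J' J(3) by (rule arg_cong2[where f = "(/)"]) Groebner_Basis.algebra+
  also have "\<dots> = - 1728 * (A * B - 3 * j6_y y) / A ^ 3"
    by (rule mult_divide_mult_cancel_left) (use m in simp)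
  finally show "i2 (sextic_C (2 * c)) = - 1728 * (A * B - 3 * j6_y y) / A ^ 3" .
  have "i3 (sextic_C (2 * c)) =
    (32 * m ^ 10 * y ^ 5 * (y + 4) ^ 5) * (- 31104 * j10_form y 1)
      / ((32 * m ^ 10 * y ^ 5 * (y + 4) ^ 5) * j2_form y 1 ^ 5)"
    unfolding i3_def J'(1) J(4) A_def by (rule arg_cong2[where f = "(/)"]) Groebner_Basis.algebra+
  also have "\<dots> = - 31104 * j10_form y 1 / j2_form y 1 ^ 5"
    by (rule mult_divide_mult_cancel_left) (use y_nz m in simp)
  finally show "i3 (sextic_C (2 * c)) = - 31104 * j10_form y 1 / j2_form y 1 ^ 5" .
qed


section \<open>Subfields and minimal polynomials\<close>

instance fract :: ("{idom, ring_char_0}") ring_char_0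
proof
  show "inj (of_nat :: nat \<Rightarrow> 'a fract)"
    by (rule injI) (simp add: of_nat_fract eq_fract)
qed

instance fract :: ("{idom, ring_char_0}") field_char_0 ..

text \<open>By the convention \<open>inverse 0 = 0\<close> the last condition may include 0.\<close>

locale closed_subfield =
  fixes K :: "'a::field set"
  assumes one_closed [simp]: "1 \<in> K"
    and add_closed [simp]: "x \<in> K \<Longrightarrow> y \<in> K \<Longrightarrow> x + y \<in> K"
    and uminus_closed [simp]: "x \<in> K \<Longrightarrow> - x \<in> K"
    and mult_closed [simp]: "x \<in> K \<Longrightarrow> y \<in> K \<Longrightarrow> x * y \<in> K"
    and inverse_closed [simp]: "x \<in> K \<Longrightarrow> inverse x \<in> K"
begin

lemma zero_closed [simp]: "0 \<in> K"
  using add_closed[OF one_closed uminus_closed[OF one_closed]] by simp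

lemma diff_closed [simp]: "x \<in> K \<Longrightarrow> y \<in> K \<Longrightarrow> x - y \<in> K"
  using add_closed[of x "- y"] by simp

lemma divide_closed [simp]: "x \<in> K \<Longrightarrow> y \<in> K \<Longrightarrow> x / y \<in> K"
  by (simp add: divide_inverse)

lemma power_closed [simp]: "x \<in> K \<Longrightarrow> x ^ n \<in> K"
  by (induction n) simp_all

lemma numeral_closed [simp]: "numeral n \<in> K"
proof -
  have "of_nat m \<in> K" for m by (induction m) simp_all
  then show ?thesis by (metis of_nat_numeral)
qed

lemma sum_closed: "(\<And>i. i \<in> A \<Longrightarrow> f i \<in> K) \<Longrightarrow> sum f A \<in> K"
  by (induction A rule: infinite_finite_induct) simp_all

definition poly_over :: "'a poly \<Rightarrow> bool" where
  "poly_over p \<longleftrightarrow> (\<forall>i. coeff p i \<in> K)"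

lemma poly_over_pCons [simp]: "poly_over (pCons c p) \<longleftrightarrow> c \<in> K \<and> poly_over p"
  unfolding poly_over_def by (metis coeff_pCons_0 coeff_pCons_Suc not0_implies_Suc)

lemma poly_over_0 [simp]: "poly_over 0"
  by (simp add: poly_over_def)

lemma poly_over_1 [simp]: "poly_over 1"
  by (simp add: one_pCons)

lemma poly_over_numeral [simp]: "poly_over (numeral n)"
  by (simp add: numeral_poly)

lemma poly_over_uminus [simp]: "poly_over p \<Longrightarrow> poly_over (- p)"
  by (simp add: poly_over_def)

lemma poly_over_add [simp]: "poly_over p \<Longrightarrow> poly_over q \<Longrightarrow> poly_over (p + q)"
  by (simp add: poly_over_def)

lemma poly_over_diff [simp]: "poly_over p \<Longrightarrow> poly_over q \<Longrightarrow> poly_over (p - q)"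
  by (simp add: poly_over_def)

lemma poly_over_mult [simp]: "poly_over p \<Longrightarrow> poly_over q \<Longrightarrow> poly_over (p * q)"
  by (simp add: poly_over_def coeff_mult sum_closed)

lemma poly_over_smult [simp]: "c \<in> K \<Longrightarrow> poly_over p \<Longrightarrow> poly_over (Polynomial.smult c p)"
  by (simp add: poly_over_def)

lemma poly_over_power [simp]: "poly_over p \<Longrightarrow> poly_over (p ^ n)"
  by (induction n) simp_all

text \<open>Dividing by a monic polynomial introduces no coefficients outside \<open>K\<close>.\<close>

lemma poly_over_mod:
  assumes g: "poly_over g" "lead_coeff g = 1"
  shows "poly_over p \<Longrightarrow> poly_over (p mod g)"
proof (induction "degree p" arbitrary: p rule: less_induct)
  case less
  show ?case
  proof (cases "degree p < degree g \<or> p = 0")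
    case True
    then show ?thesis using less.prems by (auto simp: mod_poly_less)
  next
    case False
    define m where "m = Polynomial.monom (lead_coeff p) (degree p - degree g)"
    define q where "q = p - m * g"
    have "m \<noteq> 0" "g \<noteq> 0" using False g(2) by (auto simp: m_def monom_eq_0_iff)
    then have deg_m: "degree (m * g) = degree p"
      using False by (simp add: degree_mult_eq) (simp add: m_def degree_monom_eq)
    have lead_m: "lead_coeff (m * g) = lead_coeff p"
      unfolding lead_coeff_mult using False g(2) by (simp add: m_def degree_monom_eq)
    have over_m: "poly_over m"
      using less.prems by (simp add: m_def poly_over_def coeff_monom)
    have q: "poly_over q"
      using less.prems over_m g(1) by (simp add: q_def)
    have mod_q: "q mod g = p mod g"
      by (simp add: q_def mod_diff_eq [symmetric] flip: mod_diff_right_eq)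
    show ?thesis
    proof (cases "q = 0 \<or> degree p = 0")
      case True
      then show ?thesis
      proof
        assume "degree p = 0"
        then have "degree g = 0" using False by simp
        then have "g = 1" using g(2) by (metis degree_0_id one_pCons)
        then show ?thesis by simp
      qed (use mod_q in auto)
    next
      case nz: False
      have "degree q < degree p"
        unfolding q_def using nz lead_m deg_m
        by (intro degree_less_if_less_eqI) (auto simp: degree_diff_le q_def)
      then show ?thesis
        using less.hyps[OF _ q] mod_q by simp
    qed
  qed
qed

lemma minimal_polynomial:
  assumes "poly_over p" "p \<noteq> 0" "poly p s = 0"
  obtains g where "poly_over g" "lead_coeff g = 1" "poly g s = 0"
    "\<And>q. poly_over q \<Longrightarrow> poly q s = 0 \<Longrightarrow> g dvd q"
proof -
  define ann where "ann q \<longleftrightarrow> poly_over q \<and> q \<noteq> 0 \<and> poly q s = 0" for q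
  define f where "f = arg_min degree ann"
  have f: "ann f" and f_min: "\<And>q. ann q \<Longrightarrow> degree f \<le> degree q"
    using arg_min_nat_lemma[of ann p degree] assms by (auto simp: ann_def f_def)
  define g where "g = Polynomial.smult (inverse (lead_coeff f)) f"
  have g: "poly_over g" "lead_coeff g = 1" "poly g s = 0" "degree g = degree f"
    using f by (auto simp: g_def ann_def poly_over_def)
  have "g dvd q" if q: "poly_over q" "poly q s = 0" for q
  proof (rule ccontr)
    assume "\<not> g dvd q"
    then have "q mod g \<noteq> 0" by (simp add: dvd_eq_mod_eq_0)
    moreover have "poly (q mod g) s = 0"
      using q(2) g(3) by (metis div_mult_mod_eq add_0 mult_zero_right poly_add poly_mult)
    ultimately have "ann (q mod g)"
      using poly_over_mod[OF g(1,2) q(1)] by (simp add: ann_def)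
    then have "degree g \<le> degree (q mod g)" using f_min g(4) by simp
    moreover have "degree (q mod g) < degree g"
      using \<open>q mod g \<noteq> 0\<close> g(2) by (metis degree_mod_less leading_coeff_0_iff zero_neq_one)
    ultimately show False by simp
  qed
  with g that show thesis by blast
qed

end

text \<open>
  A criterion for \<open>K(s) = K\<close> by specialising the variable of \<open>\<complex>(a)\<close> at \<open>t\<close>. The polynomials
  \<open>p1\<close> and \<open>p2\<close> over \<open>K\<close> vanish at \<open>s\<close>, so the minimal polynomial of \<open>s\<close> divides both. By
  Gauss's lemma its primitive part \<open>h\<close> divides the polynomials \<open>P1\<close> and \<open>P2\<close> over \<open>\<complex>[a]\<close>,
  which are multiples of \<open>p1\<close> and \<open>p2\<close>. Since specialisation preserves the degree of \<open>P2\<close>, it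
  preserves the degree of its factor \<open>h\<close>; the hypothesis on common divisors then bounds this
  degree by 1. In the application \<open>P1\<close> does lose roots to infinity, which is why degrees are
  compared through \<open>P2\<close>.
\<close>

lemma mem_subfield_of_simple_fibre:
  fixes K :: "ratfun set" and P1 P2 :: "complex poly poly" and t :: complex
  defines "ev \<equiv> map_poly (\<lambda>q. poly q t)"
  assumes K: "closed_subfield K"
    and p1: "closed_subfield.poly_over K p1" "poly p1 s = 0"
      "map_poly to_fract P1 = Polynomial.smult c1 p1"
    and p2: "closed_subfield.poly_over K p2" "poly p2 s = 0"
      "map_poly to_fract P2 = Polynomial.smult c2 p2"
    and deg: "ev P2 \<noteq> 0" "degree (ev P2) = degree P2"
    and fibre: "\<And>h. h dvd ev P1 \<Longrightarrow> h dvd ev P2 \<Longrightarrow> degree h \<le> 1"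
  shows "s \<in> K"
proof -
  interpret closed_subfield K by (rule K)
  interpret ev: map_poly_comm_ring_hom "\<lambda>q. poly q t"
    by unfold_locales simp_all
  have "P2 \<noteq> 0" using deg(1) by (auto simp: ev_def)
  then have "p2 \<noteq> 0" using p2(3) by auto
  then obtain g where g: "poly_over g" "lead_coeff g = 1" "poly g s = 0"
    and g_dvd: "\<And>q. poly_over q \<Longrightarrow> poly q s = 0 \<Longrightarrow> g dvd q"
    using minimal_polynomial[of p2 s] p2 by blast
  define h where "h = primitive_part_fract g"
  have "g \<noteq> 0" using g(2) by auto
  then have content: "content h = 1" by (simp add: h_def)
  have g_eq: "g = Polynomial.smult (fract_content g) (map_poly to_fract h)"
    by (simp add: h_def content_times_primitive_part_fract)
  have "map_poly to_fract h dvd g"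
    by (subst g_eq) (rule dvd_smult, simp)
  then have "map_poly to_fract h dvd map_poly to_fract P1"
    "map_poly to_fract h dvd map_poly to_fract P2"
    unfolding p1(3) p2(3) using g_dvd[OF p1(1,2)] g_dvd[OF p2(1,2)]
    by (auto intro: dvd_smult dvd_trans)
  then have dvd: "h dvd P1" "h dvd P2"
    using content by (auto intro: fract_poly_dvdD)
  then obtain k where k: "P2 = h * k" by (auto elim: dvdE)
  have "ev P2 = ev h * ev k" by (simp add: k ev_def ev.hom_mult)
  then have "degree (ev h) + degree (ev k) = degree h + degree k"
    using deg \<open>P2 \<noteq> 0\<close> k by (metis degree_mult_eq mult_zero_left mult_zero_right)
  moreover have "degree (ev h) \<le> degree h" "degree (ev k) \<le> degree k"
    by (simp_all add: ev_def degree_map_poly_le)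
  ultimately have "degree h = degree (ev h)" by simp
  moreover have "degree (ev h) \<le> 1"
    using dvd by (intro fibre) (auto simp: ev_def intro: ev.hom_dvd)
  ultimately have "degree (map_poly to_fract h :: ratfun poly) \<le> 1"
    using degree_map_poly_le[of to_fract h] by simp
  then have "degree g \<le> 1"
    by (subst g_eq) (simp add: \<open>g \<noteq> 0\<close>)
  then have "g = [:coeff g 0, coeff g 1:]"
    by (intro poly_eqI) (auto simp: coeff_pCons coeff_eq_0 split: nat.splits)
  then obtain c d where cd: "g = [:c, d:]" by blast
  show ?thesis
  proof (cases "d = 0")
    case True
    then show ?thesis using g cd by simp
  next
    case False
    then have "s = - c" "d = 1" using g cd by (auto simp: eq_neg_iff_add_eq_0 add.commute)
    then show ?thesis using g cd by simp
  qed
qed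


section \<open>Subfields generated over the constants\<close>

lemma ring_of_type_algebra_simps [simp]:
  "x \<otimes>\<^bsub>ring_of_type_algebra\<^esub> y = x * y" "\<one>\<^bsub>ring_of_type_algebra\<^esub> = 1"
  "\<zero>\<^bsub>ring_of_type_algebra\<^esub> = 0" "x \<oplus>\<^bsub>ring_of_type_algebra\<^esub> y = x + y"
  "carrier ring_of_type_algebra = UNIV"
  by (simp_all add: ring_of_type_algebra_def)

lemma a_inv_ring_of_type_algebra [simp]:
  "\<ominus>\<^bsub>ring_of_type_algebra\<^esub> x = - (x :: 'a::field)"
proof -
  interpret field "ring_of_type_algebra :: 'a ring" by (rule field_from_type_algebra)
  show ?thesis by (rule minus_equality) simp_all
qed

lemma m_inv_ring_of_type_algebra:
  assumes "x \<noteq> 0"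
  shows "inv\<^bsub>ring_of_type_algebra\<^esub> x = inverse (x :: 'a::field)"
proof -
  interpret field "ring_of_type_algebra :: 'a ring" by (rule field_from_type_algebra)
  show ?thesis by (rule comm_inv_char) (use assms in simp_all)
qed

lemma closed_subfield_generate_field:
  "closed_subfield (generate_field ring_of_type_algebra (S :: 'a::field set))"
  (is "closed_subfield ?K")
proof
  show "1 \<in> ?K" using generate_field.one[of ring_of_type_algebra S] by simp
  fix x y :: 'a
  show "x + y \<in> ?K" "x * y \<in> ?K" if "x \<in> ?K" "y \<in> ?K"
    using generate_field.eng_add[OF that] generate_field.eng_mult[OF that] by simp_all
  show "- x \<in> ?K" if "x \<in> ?K"
    using generate_field.a_inv[OF that] by simp
  show "inverse x \<in> ?K" if "x \<in> ?K"
  proof (cases "x = 0")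
    case False
    then show ?thesis
      using generate_field.m_inv[OF that] by (simp add: m_inv_ring_of_type_algebra)
  qed (use that in simp)
qed

lemma closed_subfield_C_adjoin: "closed_subfield (C_adjoin S)"
  unfolding C_adjoin_def by (rule closed_subfield_generate_field)

lemma C_adjoin_incl: "x \<in> S \<Longrightarrow> x \<in> C_adjoin S"
  unfolding C_adjoin_def by (auto intro: generate_field.incl)

lemma C_adjoin_subset:
  assumes "S \<subseteq> C_adjoin S'"
  shows "C_adjoin S \<subseteq> C_adjoin S'"
proof
  interpret closed_subfield "C_adjoin S'" by (rule closed_subfield_C_adjoin)
  have const: "const_rf c \<in> C_adjoin S'" for c
    unfolding C_adjoin_def by (auto intro: generate_field.incl)
  fix x assume "x \<in> C_adjoin S"
  then show "x \<in> C_adjoin S'"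
    unfolding C_adjoin_def[of S]
  proof (induction rule: generate_field.induct)
    case (incl h)
    then show ?case using assms const by auto
  qed (simp_all add: m_inv_ring_of_type_algebra)
qed


section \<open>The special fibre\<close>

text \<open>
  The same forms are needed for elements of \<open>\<complex>(a)\<close>, for polynomials over it, and for their
  specialisations; ring homomorphisms carry one to the other.
\<close>

lemma (in comm_ring_hom) hom_forms:
  "hom (j2_form u v) = j2_form (hom u) (hom v)"
  "hom (j4_form u v) = j4_form (hom u) (hom v)"
  "hom (j10_form u v) = j10_form (hom u) (hom v)"
  by (simp_all add: j2_form_def j4_form_def j10_form_def hom_distribs)

lemma (in closed_subfield) form_closed:
  "poly_over (j2_form [:0, 1:] 1)" "poly_over (j4_form [:0, 1:] 1)"
  "poly_over (j10_form [:0, 1:] 1)"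
  by (simp_all add: j2_form_def j4_form_def j10_form_def del: mult_pCons_left mult_pCons_right)

lemma poly_forms:
  "poly (j2_form p q) x = j2_form (poly p x) (poly q x)"
  "poly (j4_form p q) x = j4_form (poly p x) (poly q x)"
  "poly (j10_form p q) x = j10_form (poly p x) (poly q x)"
  by (simp_all add: j2_form_def j4_form_def j10_form_def)

lemma forms_scale:
  "j2_form (k * u) (k * v) = k ^ 6 * j2_form u v"
  "j4_form (k * u) (k * v) = k ^ 12 * j4_form u v"
  "j10_form (k * u) (k * v) = k ^ 23 * j10_form u v"
  for u v k :: "'a::idom"
  unfolding j2_form_def j4_form_def j10_form_def by Groebner_Basis.algebra+

lemma j2_form_X:
  "j2_form [:0, 1:] 1 = [:42500, -248900, -337237, -152568, -28544, -1600, 64 :: 'a::comm_ring_1:]"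
  by (simp add: j2_form_def numeral_poly power_numeral_reduce power2_eq_square)

lemma j4_form_X:
  "j4_form [:0, 1:] 1 = [:-412109375, -1116875000, -120300000, 1660903000, 2074932020,
    1297538800, 508429344, 134080192, 24331472, 3013888, 244608, 11776, 256 :: 'a::comm_ring_1:]"
  by (simp add: j4_form_def numeral_poly numeral_eq_Suc)

lemma coprime_linear:
  fixes p :: "'a::field_gcd poly"
  assumes "poly p r \<noteq> 0"
  shows "coprime p [:- r, 1:]"
proof -
  have "prime_elem [:- r, 1:]" by (rule prime_elem_linear_field_poly) simp
  moreover have "\<not> [:- r, 1:] dvd p" using assms by (simp add: poly_eq_0_iff_dvd)
  ultimately have "coprime [:- r, 1:] p" by (rule prime_elem_imp_coprime)
  then show ?thesis by (simp only: coprime_commute)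
qed

lemma numeral_ratfun_poly: "to_fract (numeral n :: complex poly) = numeral n"
  by (simp add: to_fract_def numeral_ratfun)

text \<open>
  The quotient coordinate \<open>(c - 1)\<^sup>2 / c\<close>, expressed through \<open>a = 2 c\<close>.
\<close>

definition y_rf :: ratfun where
  "y_rf = (a_rf - 2) ^ 2 / (2 * a_rf)"

definition y_num :: "complex poly" where "y_num = [:-2, 1:] ^ 2"
definition y_den :: "complex poly" where "y_den = [:0, 2:]"

lemma to_fract_power: "to_fract (x ^ n) = to_fract x ^ n"
  by (induction n) simp_all

lemma a_rf_eq: "a_rf = to_fract [:0, 1:]"
  by (simp add: a_rf_def to_fract_def)

lemma y_rf_eq: "y_rf * to_fract y_den = to_fract y_num"
  and y_den_nz: "y_den \<noteq> 0"
proof -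
  have "to_fract [:-2, 1:] = a_rf - 2"
  proof -
    have "[:-2, 1:] = [:0, 1:] - (2 :: complex poly)" by (simp add: numeral_poly)
    then show ?thesis by (simp only: to_fract_diff a_rf_eq numeral_ratfun_poly)
  qed
  then have num: "to_fract y_num = (a_rf - 2) ^ 2"
    by (simp only: y_num_def power2_eq_square to_fract_mult)
  have "y_den = 2 * [:0, 1:]" by (simp add: y_den_def numeral_poly)
  then have den: "to_fract y_den = 2 * a_rf"
    by (metis to_fract_mult a_rf_eq numeral_ratfun_poly)
  show nz: "y_den \<noteq> 0" by (simp add: y_den_def)
  then show "y_rf * to_fract y_den = to_fract y_num"
    unfolding num y_rf_def den by (metis den nonzero_eq_divide_eq to_fract_eq_0_iff)
qed

lemma to_fract_hom: "comm_ring_hom (to_fract :: 'a::idom \<Rightarrow> 'a fract)"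
  by unfold_locales simp_all

text \<open>Homogeneity clears the denominators, so that specialisation at \<open>a = 2\<close> makes sense.\<close>

lemma forms_y_rf:
  "to_fract (j2_form y_num y_den) = to_fract y_den ^ 6 * j2_form y_rf 1"
  "to_fract (j4_form y_num y_den) = to_fract y_den ^ 12 * j4_form y_rf 1"
  "to_fract (j10_form y_num y_den) = to_fract y_den ^ 23 * j10_form y_rf 1"
  unfolding comm_ring_hom.hom_forms[OF to_fract_hom] y_rf_eq [symmetric]
  using forms_scale[of "to_fract y_den" y_rf 1] by (simp_all add: mult.commute)

lemma j2_form_y_rf: "j2_form y_rf 1 \<noteq> 0"
proof
  assume "j2_form y_rf 1 = 0"
  then have "j2_form y_num y_den = 0" using forms_y_rf(1) by simp
  then have "poly (j2_form y_num y_den) 2 = 0" by simp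
  then show False by (simp add: poly_forms y_num_def y_den_def) (simp add: j2_form_def)
qed

text \<open>
  Its roots are the points \<open>y\<close> where \<open>i\<^sub>1\<close> has the same value as at \<open>y = 0\<close>.
\<close>

definition i1_fibre :: "complex poly" where
  "i1_fibre = Polynomial.smult (j2_form 0 1 ^ 2) (j4_form [:0, 1:] 1)
    - Polynomial.smult (j4_form 0 1) (j2_form [:0, 1:] 1 ^ 2)"

text \<open>
  The degree says that \<open>i\<^sub>1(\<infinity>) \<noteq> i\<^sub>1(0)\<close>; the four values exclude the zeros of \<open>i\<^sub>3\<close> other
  than \<open>0\<close> and \<open>\<infinity>\<close>.
\<close>

lemma i1_fibre_avoids_zeros_of_i3:
  shows "degree i1_fibre = 12"
    and "poly i1_fibre (- 4) \<noteq> 0" and "poly i1_fibre (- 25 / 4) \<noteq> 0"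
    and "poly i1_fibre (Complex (- 7 / 2) (1 / 2)) \<noteq> 0"
    and "poly i1_fibre (Complex (- 7 / 2) (- 1 / 2)) \<noteq> 0"
proof -
  have at_0: "j2_form 0 1 = (42500 :: complex)" "j4_form 0 1 = (- 412109375 :: complex)"
    by (simp_all add: j2_form_def j4_form_def)
  show "degree i1_fibre = 12"
    unfolding i1_fibre_def at_0 j2_form_X j4_form_X by (simp add: power2_eq_square)
  have M: "poly i1_fibre r = 42500 ^ 2 * j4_form r 1 + 412109375 * j2_form r 1 ^ 2" for r
    by (simp add: i1_fibre_def at_0 poly_forms)
  show "poly i1_fibre (- 4) \<noteq> 0" "poly i1_fibre (- 25 / 4) \<noteq> 0"
    unfolding M j2_form_def j4_form_def by (simp_all add: power_divide)
  have "poly i1_fibre r \<noteq> 0" if r: "r = Complex (- 7 / 2) e" and e: "e * e = 1 / 4" for r e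
  proof -
    have q: "2 * r ^ 2 + 14 * r + 25 = 0"
      using e by (simp add: r complex_eq_iff power2_eq_square)
    \<comment> \<open>The values at \<open>r\<close> are the remainders modulo the quadratic factor, whose root \<open>r\<close> is.\<close>
    have "2 * j2_form r 1 = (2 * r ^ 2 + 14 * r + 25)
        * (3747 - 21912 * r - 15008 * r ^ 2 - 2048 * r ^ 3 + 64 * r ^ 4) + (- 8675 - 2458 * r)"
      unfolding j2_form_def power_one mult_1_right by Groebner_Basis.algebra
    then have j2: "j2_form r 1 = (- 8675 - 2458 * r) / 2"
      unfolding q by (simp add: mult.commute)
    have "j4_form r 1 = (2 * r ^ 2 + 14 * r + 25)
        * (- 16487728 - 35442696 * r + 16354928 * r ^ 2 + 60112776 * r ^ 3 + 48025732 * r ^ 4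
          + 20198120 * r ^ 5 + 5184168 * r ^ 6 + 844224 * r ^ 7 + 85760 * r ^ 8 + 4992 * r ^ 9
          + 128 * r ^ 10) + (83825 + 20592 * r)"
      unfolding j4_form_def power_one mult_1_right by Groebner_Basis.algebra
    then have j4: "j4_form r 1 = 83825 + 20592 * r" unfolding q by simp
    show ?thesis
      unfolding M j2 j4 using e by (auto simp: r complex_eq_iff power2_eq_square algebra_simps)
  qed
  then show "poly i1_fibre (Complex (- 7 / 2) (1 / 2)) \<noteq> 0"
    "poly i1_fibre (Complex (- 7 / 2) (- 1 / 2)) \<noteq> 0"
    by simp_all
qed

text \<open>The fibre of \<open>(i\<^sub>1, i\<^sub>3)\<close> through \<open>y = 0\<close> is this single point, with multiplicity 1.\<close>

lemma common_divisor_fibre: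
  fixes h :: "complex poly"
  assumes "h dvd j10_form [:0, 1:] 1" and "h dvd i1_fibre"
  shows "degree h \<le> 1"
proof -
  let ?p = "\<lambda>r. [:- r, 1:] :: complex poly"
  define R where "R = ?p (- 4) ^ 7 * ?p (- 25 / 4) ^ 5 *
    (?p (Complex (- 7 / 2) (1 / 2)) * ?p (Complex (- 7 / 2) (- 1 / 2))) ^ 5"
  have "coprime i1_fibre R"
    unfolding R_def using i1_fibre_avoids_zeros_of_i3(2-)
    by (intro coprime_mult_right_iff [THEN iffD2] conjI
      coprime_power_right_iff [THEN iffD2] disjI1 coprime_linear)
  then have "coprime h R" using assms(2) by (meson coprime_divisors dvd_refl)
  have 1: "[:0, 1:] + 4 * 1 = ?p (- 4)" by (simp add: numeral_poly)
  have 2: "4 * [:0, 1:] + 25 * 1 = 4 * ?p (- 25 / 4)" by (simp add: numeral_poly)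
  have 3: "2 * [:0, 1:] ^ 2 + 14 * [:0, 1:] * 1 + 25 * 1 ^ 2 =
      2 * (?p (Complex (- 7 / 2) (1 / 2)) * ?p (Complex (- 7 / 2) (- 1 / 2)))"
    by (simp add: numeral_poly power2_eq_square complex_eq_iff)
  have "j10_form [:0, 1:] 1 = 32768 * ([:0, 1:] * R)"
    unfolding j10_form_def 1 2 3 R_def by Groebner_Basis.algebra
  then have "j10_form [:0, 1:] 1 = Polynomial.smult 32768 ([:0, 1:] * R)"
    by (simp add: numeral_poly)
  then have "h dvd [:0, 1:] * R"
    using assms(1) dvd_smult_cancel[of h 32768 "[:0, 1:] * R"] by simp
  then have "h dvd [:0, 1:]"
    using \<open>coprime h R\<close> by (simp only: coprime_dvd_mult_left_iff)
  then show ?thesis using dvd_imp_degree_le[of h "[:0, 1:]"] by simp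
qed

text \<open>
  The criterion \<open>mem_subfield_of_simple_fibre\<close> is applied with the equations that define \<open>i\<^sub>3\<close>
  and \<open>i\<^sub>1\<close> as functions of \<open>y\<close>, specialised at \<open>a = 2\<close>; the equation for \<open>i\<^sub>1\<close> is the one
  that keeps its degree.
\<close>

lemma y_rf_mem:
  assumes K: "closed_subfield K"
    and x: "j4_form y_rf 1 / j2_form y_rf 1 ^ 2 \<in> K" (is "?x \<in> K")
    and w: "j10_form y_rf 1 / j2_form y_rf 1 ^ 5 \<in> K" (is "?w \<in> K")
  shows "y_rf \<in> K"
proof -
  interpret closed_subfield K by (rule K)
  \<comment> \<open>The power of \<open>y_den\<close> brings both sides of the equation for \<open>i\<^sub>3\<close> to degree 30; it reflects the
    zero of \<open>i\<^sub>3\<close> at infinity.\<close>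
  define A B N :: "complex poly" where "A = j2_form y_num y_den" and "B = j4_form y_num y_den"
    and "N = j10_form y_num y_den * y_den ^ 7"
  define d where "d = to_fract y_den"
  define P1 where "P1 = Polynomial.smult (A ^ 5) (j10_form [:0, 1:] 1)
    - Polynomial.smult N (j2_form [:0, 1:] 1 ^ 5)"
  define P2 where "P2 = Polynomial.smult (A ^ 2) (j4_form [:0, 1:] 1)
    - Polynomial.smult B (j2_form [:0, 1:] 1 ^ 2)"
  define p1 where "p1 = j10_form [:0, 1:] 1 - Polynomial.smult ?w (j2_form [:0, 1:] 1 ^ 5)"
  define p2 where "p2 = j4_form [:0, 1:] 1 - Polynomial.smult ?x (j2_form [:0, 1:] 1 ^ 2)"
  have over: "poly_over p1" "poly_over p2"
    using x w by (simp_all add: p1_def p2_def form_closed)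
  have roots: "poly p1 y_rf = 0" "poly p2 y_rf = 0"
    using j2_form_y_rf by (simp_all add: p1_def p2_def poly_forms)
  interpret F: map_poly_comm_ring_hom "to_fract :: complex poly \<Rightarrow> ratfun"
    by unfold_locales simp_all
  have toA: "to_fract A = d ^ 6 * j2_form y_rf 1" and toB: "to_fract B = d ^ 12 * j4_form y_rf 1"
    and toN: "to_fract N = d ^ 30 * j10_form y_rf 1"
    using forms_y_rf by (simp_all add: A_def B_def N_def d_def to_fract_power flip: power_add)
  have scal: "to_fract N = to_fract A ^ 5 * ?w" "to_fract B = to_fract A ^ 2 * ?x"
    unfolding toA toB toN using j2_form_y_rf by (simp_all add: power_mult_distrib flip: power_mult)
  have X: "map_poly to_fract [:0, 1 :: complex poly:] = [:0, 1:]" by simp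
  have P1: "map_poly to_fract P1 = Polynomial.smult (to_fract A ^ 5) p1"
    unfolding P1_def p1_def F.hom_minus fract_poly_smult to_fract_power
      F.hom_power F.hom_forms X F.hom_one scal(1)
    by (simp add: smult_diff_right)
  have P2: "map_poly to_fract P2 = Polynomial.smult (to_fract A ^ 2) p2"
    unfolding P2_def p2_def F.hom_minus fract_poly_smult to_fract_power
      F.hom_power F.hom_forms X F.hom_one scal(2)
    by (simp add: smult_diff_right)
  interpret ev: map_poly_comm_ring_hom "\<lambda>q. poly q (2 :: complex)" by unfold_locales simp_all
  have ev_smult: "map_poly (\<lambda>q. poly q 2) (Polynomial.smult c p) =
      Polynomial.smult (poly c 2) (map_poly (\<lambda>q. poly q 2) p)" for c and p :: "complex poly poly"
    by (rule poly_eqI) (simp add: coeff_map_poly)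
  have evX: "map_poly (\<lambda>q. poly q 2) [:0, 1 :: complex poly:] = [:0, 1:]" by simp
  have A2: "poly A 2 = 4 ^ 6 * j2_form 0 1" and B2: "poly B 2 = 4 ^ 12 * j4_form 0 1"
    and N2: "poly N 2 = 0"
    by (simp_all add: A_def B_def N_def poly_forms y_num_def y_den_def)
      (simp_all add: j2_form_def j4_form_def j10_form_def)
  have evP1: "map_poly (\<lambda>q. poly q 2) P1 =
      Polynomial.smult ((4 ^ 6 * j2_form 0 1) ^ 5) (j10_form [:0, 1:] 1)"
    unfolding P1_def ev.hom_minus ev_smult ev.hom_power ev.hom_forms evX ev.hom_one
    by (simp add: A2 N2)
  have evP2: "map_poly (\<lambda>q. poly q 2) P2 = Polynomial.smult (4 ^ 12) i1_fibre"
    unfolding P2_def ev.hom_minus ev_smult ev.hom_power ev.hom_forms evX ev.hom_one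
    by (simp add: A2 B2 i1_fibre_def smult_diff_right)
  have deg_ev: "degree (map_poly (\<lambda>q. poly q 2) P2) = 12"
    unfolding evP2 using i1_fibre_avoids_zeros_of_i3(1) by simp
  have "degree P2 \<le> 12"
    unfolding P2_def j2_form_X j4_form_X
    by (intro degree_diff_le order.trans[OF degree_smult_le]
      order.trans[OF degree_power_le]) simp_all
  moreover have "degree (map_poly (\<lambda>q. poly q 2) P2) \<le> degree P2"
    by (rule degree_map_poly_le)
  ultimately have deg: "degree (map_poly (\<lambda>q. poly q 2) P2) = degree P2"
    using deg_ev by simp
  show ?thesis
  proof (rule mem_subfield_of_simple_fibre[OF K over(1) roots(1) P1 over(2) roots(2) P2 _ deg])
    show "map_poly (\<lambda>q. poly q 2) P2 \<noteq> 0" using deg_ev by auto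
    fix h assume "h dvd map_poly (\<lambda>q. poly q 2) P1" "h dvd map_poly (\<lambda>q. poly q 2) P2"
    then show "degree h \<le> 1"
      unfolding evP1 evP2 by (intro common_divisor_fibre) (simp_all add: dvd_smult_iff j2_form_def)
  qed
qed


section \<open>The function field\<close>

theorem proposition1:
  shows "function_field_Y1 = C_adjoin {((a_rf - 2) / (5 * (a_rf + 2))) ^ 2}"
proof -
  define T where "T = ((a_rf - 2) / (5 * (a_rf + 2))) ^ 2"
  define c where "c = a_rf / 2"
  have a: "a_rf = 2 * c" by (simp add: c_def)
  define C where "C = [:0, 1 / 2 :: complex:]"
  have c_eq: "c = to_fract C"
  proof -
    have "2 * C = [:0, 1:]" by (simp add: C_def numeral_poly)
    then have "a_rf = 2 * to_fract C" by (metis a_rf_eq numeral_ratfun_poly to_fract_mult)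
    then show ?thesis by (simp add: c_def mult.commute)
  qed
  have "C \<noteq> 0" "C \<noteq> 1" "C + 1 \<noteq> 0" "4 * C + 1 \<noteq> 0" "C ^ 2 + 2 * C + 2 \<noteq> 0"
    by (simp_all add: C_def numeral_poly power2_eq_square one_pCons)
  then have c: "c \<noteq> 0" "c \<noteq> 1" "c + 1 \<noteq> 0" "4 * c + 1 \<noteq> 0" "c ^ 2 + 2 * c + 2 \<noteq> 0"
    unfolding c_eq numeral_ratfun_poly [symmetric] to_fract_1 [symmetric]
    by (simp_all only: to_fract_eq_0_iff to_fract_eq_iff not_False_eq_True
        flip: to_fract_add to_fract_mult to_fract_power)
  have y: "y_rf = (c - 1) ^ 2 / c"
    using c(1) by (simp add: y_rf_def a field_simps power2_eq_square)
  note i = absolute_invariants_C[OF c, folded a y]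
  have y4_eq: "y_rf + 4 = (c + 1) ^ 2 / c"
    using c(1) by (simp add: y field_simps power2_eq_square)
  have "(a_rf - 2) / (5 * (a_rf + 2)) = (2 * (c - 1)) / (2 * (5 * (c + 1)))"
    unfolding a by (simp add: algebra_simps)
  also have "\<dots> = (c - 1) / (5 * (c + 1))"
    by (rule mult_divide_mult_cancel_left) simp
  finally have "T = (c - 1) ^ 2 / (5 * (c + 1)) ^ 2"
    by (simp only: T_def power_divide)
  then have "T = (c - 1) ^ 2 / (25 * (c + 1) ^ 2)"
    by (simp only: power_mult_distrib) simp
  then have T_y: "T = y_rf / (25 * (y_rf + 4))"
    using c(1) unfolding y4_eq by (simp add: y)
  have "y_rf + 4 \<noteq> 0" using c by (simp add: y4_eq)
  then obtain w where w: "y_rf = w - 4" "w \<noteq> 0"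
    by (metis add_diff_cancel_right')
  have "1 - 25 * T = 4 / w" "100 * T = 4 * (w - 4) / w"
    unfolding T_y w(1) using w(2) by (simp_all add: field_simps)
  then have "100 * T / (1 - 25 * T) = w - 4"
    using w(2) by simp
  then have y_T: "y_rf = 100 * T / (1 - 25 * T)"
    by (simp only: w(1))
  show ?thesis
    unfolding function_field_Y1_def T_def [symmetric]
  proof (intro equalityI C_adjoin_subset)
    interpret closed_subfield "C_adjoin {T}" by (rule closed_subfield_C_adjoin)
    have "y_rf \<in> C_adjoin {T}"
      unfolding y_T using C_adjoin_incl[of T "{T}"] by simp
    then have forms_mem: "j2_form y_rf 1 \<in> C_adjoin {T}" "j4_form y_rf 1 \<in> C_adjoin {T}"
      "j10_form y_rf 1 \<in> C_adjoin {T}" "j6_y y_rf \<in> C_adjoin {T}" "y_rf \<in> C_adjoin {T}"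
      by (simp_all add: j2_form_def j4_form_def j10_form_def j6_y_def Let_def
        prod15_y_def prod24_y_def coeff3_y_def mixed_y_def)
    then show "{i1 (sextic_C a_rf), i2 (sextic_C a_rf), i3 (sextic_C a_rf)} \<subseteq> C_adjoin {T}"
      unfolding i by (simp add: forms_mem)
  next
    let ?K = "C_adjoin {i1 (sextic_C a_rf), i2 (sextic_C a_rf), i3 (sextic_C a_rf)}"
    interpret closed_subfield ?K by (rule closed_subfield_C_adjoin)
    have i_mem: "i1 (sextic_C a_rf) / 144 \<in> ?K" "i3 (sextic_C a_rf) / - 31104 \<in> ?K"
      using C_adjoin_incl by (auto intro!: divide_closed)
    have "y_rf \<in> ?K"
      by (rule y_rf_mem[OF closed_subfield_C_adjoin]) (use i_mem in \<open>simp_all add: i\<close>)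
    then show "{T} \<subseteq> ?K" unfolding T_y by simp
  qed
qed
end
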